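(* Let $X(t)$, $t\ge0$, be a finite SZK model on $\{0,1,\dots,S\}$, that is, a continuous-time Markov chain with intensities $q_{i,i+k}(t)=\lambda_k(t)$ (for $k\ge1$, $i+k\le S$) and $q_{i,i-k}(t)=\mu_k(t)$ (for $k\ge1$, $i-k\ge0$), where $\lambda_k,\mu_k$ ($1\le k\le S$) are nonnegative and locally integrable on $[0,\infty)$, and $\lambda_{k+1}(t)\le\lambda_k(t)$, $\mu_{k+1}(t)\le\mu_k(t)$ for all $1\le k\le S-1$ and almost all $t\ge0$. Let $d_1,\dots,d_S$ be positive numbers, let $D$ be the upper triangular $S\times S$ matrix with entries $D_{ij}=d_i$ for $j\ge i$ and $D_{ij}=0$ for $j<i$, and let $H(t)=(h_{ij}(t))_{i,j=1}^S=DB(t)D^{-1}$, where $B(t)=(a_{ij}(t)-a_{i0}(t))_{i,j=1}^S$. Put $$\alpha_k(t)=-\sum_{i=1}^S h_{ik}(t)\ (1\le k\le S),\qquad \beta^*(t)=\min_{1\le k\le S}\alpha_k(t),\qquad \beta_*(t)=\max_{1\le k\le S}\alpha_k(t).$$ Suppose that the positive numbers $d_i$ are such that $$\int_0^\infty\beta^*(t)\,dt=+\infty .$$ Then $X(t)$ is weakly ergodic, and for any initial probability distributions $\mathbf p^*(0),\mathbf p^{**}(0)$ and all $t\ge0$, $$\|\mathbf z^{*}(t)-\mathbf z^{**}(t)\|_{1D}\le e^{-\int_0^t\beta^*(\tau)\,d\tau}\,\|\mathbf z^{*}(0)-\mathbf z^{**}(0)\|_{1D}.$$ Moreover, if the initial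 conditions are such that $D(\mathbf z^*(0)-\mathbf z^{**}(0))\ge\mathbf 0$ (coordinatewise), then for all $t\ge0$, $$\|\mathbf z^{*}(t)-\mathbf z^{**}(t)\|_{1D}\ge e^{-\int_0^t\beta_*(\tau)\,d\tau}\,\|\mathbf z^{*}(0)-\mathbf z^{**}(0)\|_{1D}.$$
   Context: Setting. For a continuous-time Markov chain on $\{0,1,\dots,S\}$ with nonnegative locally integrable transition intensities $q_{ij}(t)$ (from $i$ to $j\ne i$), set $a_{ij}(t)=q_{ji}(t)$ for $j\ne i$ and $a_{ii}(t)=-\sum_{j\ne i}q_{ij}(t)$; $A(t)=(a_{ij}(t))_{i,j=0}^S$ is the transposed intensity matrix. For the SZK model, $a_{ij}=\lambda_{i-j}$ for $i>j$, $a_{ij}=\mu_{j-i}$ for $i<j$, and $a_{ii}=-\sum_{k=1}^{i}\mu_k-\sum_{k=1}^{S-i}\lambda_k$. The vector of state probabilities $\mathbf p(t)=(p_0(t),\dots,p_S(t))^T$ is the solution of the forward Kolmogorov system $\frac{d\mathbf p}{dt}=A(t)\mathbf p(t)$ (a locally absolutely continuous function satisfying the equation for almost all $t$); if $\mathbf p(0)$ is a probability vector then so is $\mathbf p(t)$ for every $t\ge0$. Reduced vector. $\mathbf z(t)=(p_1(t),\dots,p_S(t))^T$; using $p_0=1-\sum_{i\ge1}p_i$ it satisfies $\frac{d\mathbf z}{dt}=B(t)\mathbf z+\mathbf f(t)$ with $\mathbf f=(a_{10},\dots,a_{S0})^T$ and $B=(a_{ij}-a_{i0})_{i,j=1}^S$.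 Given two initial probability vectors $\mathbf p^*(0),\mathbf p^{**}(0)$, the corresponding solutions are $\mathbf p^*(t),\mathbf p^{**}(t)$, with reduced vectors $\mathbf z^*(t),\mathbf z^{**}(t)$. Entries of $H$. Explicitly, $h_{kk}=a_{kk}-\lambda_{S-k+1}$; for $i>k$, $h_{ik}=(\lambda_{i-k}-\lambda_{S-k+1})\frac{d_i}{d_k}$; for $i<k$, $h_{ik}=(\mu_{k-i}-\mu_k)\frac{d_i}{d_k}$. Notation. $\|\mathbf x\|=\sum_i|x_i|$ is the $l_1$-norm and $\|\mathbf z\|_{1D}=\|D\mathbf z\|$. The chain is weakly ergodic if $\|\mathbf p^*(t)-\mathbf p^{**}(t)\|\to0$ as $t\to\infty$ for any initial probability distributions $\mathbf p^*(0),\mathbf p^{**}(0)$. $\int_0^\infty\beta^*(t)\,dt$ means $\lim_{T\to\infty}\int_0^T\beta^*(t)\,dt$. *)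

theory Defs
  imports "HOL-Analysis.Analysis" "Jordan_Normal_Form.Determinant"
begin

text \<open>Absolute continuity on \<open>I\<close>: the members of a division are compact intervals
  with pairwise disjoint interiors, so \<open>Inf K\<close> and \<open>Sup K\<close> are the endpoints of \<open>K\<close>.\<close>

definition ac_on :: "real set \<Rightarrow> (real \<Rightarrow> real) \<Rightarrow> bool" where
  "ac_on I f \<longleftrightarrow>
     (\<forall>\<epsilon>>0. \<exists>\<delta>>0. \<forall>\<D> U. \<D> division_of U \<longrightarrow> U \<subseteq> I \<longrightarrow>
        (\<Sum>K\<in>\<D>. Sup K - Inf K) < \<delta> \<longrightarrow> (\<Sum>K\<in>\<D>. \<bar>f (Sup K) - f (Inf K)\<bar>) < \<epsilon>)"

definition l1_norm :: "real Matrix.vec \<Rightarrow> real" where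
  "l1_norm x = (\<Sum>i<dim_vec x. \<bar>vec_index x i\<bar>)"

definition prob_vec :: "nat \<Rightarrow> real Matrix.vec \<Rightarrow> bool" where
  "prob_vec n x \<longleftrightarrow>
     x \<in> carrier_vec n \<and> (\<forall>i<n. 0 \<le> vec_index x i) \<and> (\<Sum>i<n. vec_index x i) = 1"

text \<open>A chain on \<open>{0,\<dots>,S}\<close> is given by its intensities: \<open>q i j t\<close> is the intensity of the
  transition from \<open>i\<close> to \<open>j\<close> at time \<open>t\<close>; the values \<open>q i i t\<close> are never used.\<close>

definition transposed_intensity_matrix ::
    "nat \<Rightarrow> (nat \<Rightarrow> nat \<Rightarrow> real \<Rightarrow> real) \<Rightarrow> real \<Rightarrow> real Matrix.mat" where
  "transposed_intensity_matrix S q t =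
     Matrix.mat (S + 1) (S + 1)
       (\<lambda>(i, j). if i = j then - (\<Sum>k\<in>{0..S} - {i}. q i k t) else q j i t)"

definition forward_solution ::
    "nat \<Rightarrow> (nat \<Rightarrow> nat \<Rightarrow> real \<Rightarrow> real) \<Rightarrow> (real \<Rightarrow> real Matrix.vec) \<Rightarrow> bool" where
  "forward_solution S q p \<longleftrightarrow>
     (\<forall>t\<ge>0. p t \<in> carrier_vec (S + 1)) \<and>
     (\<forall>i\<le>S. \<forall>T\<ge>0. ac_on {0..T} (\<lambda>t. vec_index (p t) i)) \<and>
     (AE t in lebesgue_on {0..}. \<forall>i\<le>S.
        ((\<lambda>s. vec_index (p s) i) has_real_derivative
           vec_index (transposed_intensity_matrix S q t *\<^sub>v p t) i) (at t within {0..}))"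

definition state_probabilities ::
    "nat \<Rightarrow> (nat \<Rightarrow> nat \<Rightarrow> real \<Rightarrow> real) \<Rightarrow> (real \<Rightarrow> real Matrix.vec) \<Rightarrow> bool" where
  "state_probabilities S q p \<longleftrightarrow> forward_solution S q p \<and> prob_vec (S + 1) (p 0)"

definition weakly_ergodic :: "nat \<Rightarrow> (nat \<Rightarrow> nat \<Rightarrow> real \<Rightarrow> real) \<Rightarrow> bool" where
  "weakly_ergodic S q \<longleftrightarrow>
     (\<forall>p1 p2. state_probabilities S q p1 \<longrightarrow> state_probabilities S q p2 \<longrightarrow>
        ((\<lambda>t. l1_norm (p1 t - p2 t)) \<longlongrightarrow> 0) at_top)"

definition szk_intensity ::
    "(nat \<Rightarrow> real \<Rightarrow> real) \<Rightarrow> (nat \<Rightarrow> real \<Rightarrow> real) \<Rightarrow> nat \<Rightarrow> nat \<Rightarrow> real \<Rightarrow> real" where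
  "szk_intensity lam mu i j t =
     (if i < j then lam (j - i) t else if j < i then mu (i - j) t else 0)"

text \<open>Matrices and vectors are indexed from 0, whereas \<open>\<z>\<close>, \<open>B\<close>, \<open>D\<close>, \<open>H\<close> and the
  numbers \<open>d\<^sub>1,\<dots>,d\<^sub>S\<close> are indexed from 1; hence the index shifts below.\<close>

definition reduced_vec :: "nat \<Rightarrow> real Matrix.vec \<Rightarrow> real Matrix.vec" where
  "reduced_vec S p = Matrix.vec S (\<lambda>i. vec_index p (i + 1))"

definition reduced_matrix :: "nat \<Rightarrow> real Matrix.mat \<Rightarrow> real Matrix.mat" where
  "reduced_matrix S A = Matrix.mat S S (\<lambda>(i, j). A $$ (i + 1, j + 1) - A $$ (i + 1, 0))"

definition weight_matrix :: "nat \<Rightarrow> (nat \<Rightarrow> real) \<Rightarrow> real Matrix.mat" where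
  "weight_matrix S d = Matrix.mat S S (\<lambda>(i, j). if i \<le> j then d (i + 1) else 0)"

text \<open>\<open>mat_inverse\<close> does not return \<open>None\<close> here, since the weights are positive.\<close>

lemma weight_matrix_inverse:
  assumes "\<forall>k\<in>{1..S}. 0 < d k"
  obtains E where "mat_inverse (weight_matrix S d) = Some E" "E \<in> carrier_mat S S"
    "weight_matrix S d * E = 1\<^sub>m S" "E * weight_matrix S d = 1\<^sub>m S"
proof -
  have D: "weight_matrix S d \<in> carrier_mat S S"
    by (simp add: weight_matrix_def)
  have "upper_triangular (weight_matrix S d)"
    by (auto simp: weight_matrix_def)
  then have "Determinant.det (weight_matrix S d) = prod_list (diag_mat (weight_matrix S d))"
    using D by (rule det_upper_triangular)
  also have "\<dots> \<noteq> 0"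
  proof -
    have "weight_matrix S d $$ (i, i) \<noteq> 0" if "i < S" for i
      using assms[rule_format, of "i + 1"] that by (simp add: weight_matrix_def)
    then show ?thesis
      using D by (auto simp: prod_list_zero_iff diag_mat_def)
  qed
  finally have "weight_matrix S d \<in> Units (ring_mat TYPE(real) S ())"
    using D by (intro det_non_zero_imp_unit) auto
  then obtain E where "mat_inverse (weight_matrix S d) = Some E"
    using mat_inverse(1)[OF D, of "()"] by (cases "mat_inverse (weight_matrix S d)") auto
  then show ?thesis
    using mat_inverse(2)[OF D] that by blast
qed

definition norm_1D :: "nat \<Rightarrow> (nat \<Rightarrow> real) \<Rightarrow> real Matrix.vec \<Rightarrow> real" where
  "norm_1D S d z = l1_norm (weight_matrix S d *\<^sub>v z)"

definition H_matrix ::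
    "nat \<Rightarrow> (nat \<Rightarrow> nat \<Rightarrow> real \<Rightarrow> real) \<Rightarrow> (nat \<Rightarrow> real) \<Rightarrow> real \<Rightarrow> real Matrix.mat" where
  "H_matrix S q d t =
     weight_matrix S d * reduced_matrix S (transposed_intensity_matrix S q t)
       * the (mat_inverse (weight_matrix S d))"

definition alpha ::
    "nat \<Rightarrow> (nat \<Rightarrow> nat \<Rightarrow> real \<Rightarrow> real) \<Rightarrow> (nat \<Rightarrow> real) \<Rightarrow> nat \<Rightarrow> real \<Rightarrow> real" where
  "alpha S q d k t = - (\<Sum>i=1..S. H_matrix S q d t $$ (i - 1, k - 1))"

definition beta_min ::
    "nat \<Rightarrow> (nat \<Rightarrow> nat \<Rightarrow> real \<Rightarrow> real) \<Rightarrow> (nat \<Rightarrow> real) \<Rightarrow> real \<Rightarrow> real" where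
  "beta_min S q d t = (MIN k\<in>{1..S}. alpha S q d k t)"

definition beta_max ::
    "nat \<Rightarrow> (nat \<Rightarrow> nat \<Rightarrow> real \<Rightarrow> real) \<Rightarrow> (nat \<Rightarrow> real) \<Rightarrow> real \<Rightarrow> real" where
  "beta_max S q d t = (MAX k\<in>{1..S}. alpha S q d k t)"

end

theory Submission
  imports Defs
begin

text \<open>Let \<open>x = D (z\<^sup>* - z\<^sup>*\<^sup>*)\<close>. Then \<open>x' = H x\<close> almost everywhere, and
  monotonicity of the rates makes the off-diagonal entries of \<open>H\<close> nonnegative. Hence the sum \<open>V\<close>
  of the positive parts of the coordinates satisfies \<open>V(t) - V(s) \<le> - \<integral> \<beta>\<^sup>* V\<close> over
  \<open>[s, t]\<close>. The same holds for \<open>-x\<close>, and the \<open>l\<^sub>1\<close>-norm is the sum of the two. Applied to \<open>-x\<close>,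
  the estimate also shows that \<open>x \<ge> 0\<close> is preserved, and then the norm is simply the
  sum of the coordinates, which gives the lower bound.

  Neither Lebesgue differentiation nor the almost everywhere differentiability of \<open>\<integral> \<beta>\<close> is
  needed: integral inequalities for absolutely continuous functions come from a Henstock gauge that
  encloses the exceptional null set in a small open set, and the Gronwall step compares
  \<open>exp (\<integral> \<beta>) V\<close> at nearby points with an error of \<open>\<epsilon> \<integral> \<bar>\<beta>\<bar>\<close>.\<close>

hide_const (open) Polynomial.content

subsection \<open>Integrability and negligible sets\<close>

lemma integral_le_negligible:
  fixes f g :: "real \<Rightarrow> real"
  assumes "f integrable_on S" "g integrable_on S" "negligible N" "\<And>t. t \<in> S - N \<Longrightarrow> f t \<le> g t"
  shows "integral S f \<le> integral S g"
proof -
  \<comment> \<open>Overwriting \<open>g\<close> by \<open>f\<close> on \<open>N\<close> makes the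
    comparison hold everywhere on \<open>S\<close> and leaves the integral unchanged.\<close>
  let ?g = "\<lambda>t. if t \<in> N then f t else g t"
  have "?g integrable_on S"
    by (rule integrable_spike[OF assms(2,3)]) auto
  then have "integral S f \<le> integral S ?g"
    using assms by (intro integral_le) auto
  also have "\<dots> = integral S g"
    by (rule integral_spike[OF assms(3)]) auto
  finally show ?thesis .
qed

text \<open>Gauge arguments ask of each tag whether it is exceptional, so almost-everywhere
  hypotheses are traded for explicit null sets, which can also be united.\<close>

lemma AE_lebesgue_on_negligible:
  assumes "AE t in lebesgue_on S. P t" "S \<in> sets lebesgue"
  shows "\<exists>N. negligible N \<and> (\<forall>t\<in>S - N. P t)"
proof -
  have "AE t in lebesgue. t \<in> S \<longrightarrow> P t"
    using assms by (subst (asm) AE_restrict_space_iff) auto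
  then have "{t. \<not> (t \<in> S \<longrightarrow> P t)} \<in> null_sets lebesgue"
    by (simp add: completion.AE_iff_null_sets)
  then show ?thesis
    by (intro exI[of _ "{t. \<not> (t \<in> S \<longrightarrow> P t)}"]) (auto simp: negligible_iff_null_sets)
qed

lemma absolutely_integrable_Min:
  fixes f :: "'a \<Rightarrow> real \<Rightarrow> real"
  assumes "finite A" "A \<noteq> {}" "\<And>k. k \<in> A \<Longrightarrow> f k absolutely_integrable_on S"
  shows "(\<lambda>t. MIN k\<in>A. f k t) absolutely_integrable_on S"
  using assms
proof (induction A rule: finite_ne_induct)
  case (insert k A)
  then have "(\<lambda>t. min (f k t) (MIN k\<in>A. f k t)) absolutely_integrable_on S"
    by (intro absolutely_integrable_min_1) auto
  moreover have "(MIN k\<in>insert k A. f k t) = min (f k t) (MIN k\<in>A. f k t)" for t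
    using insert by simp
  ultimately show ?case by simp
qed simp

lemma absolutely_integrable_Max:
  fixes f :: "'a \<Rightarrow> real \<Rightarrow> real"
  assumes "finite A" "A \<noteq> {}" "\<And>k. k \<in> A \<Longrightarrow> f k absolutely_integrable_on S"
  shows "(\<lambda>t. MAX k\<in>A. f k t) absolutely_integrable_on S"
  using assms
proof (induction A rule: finite_ne_induct)
  case (insert k A)
  then have "(\<lambda>t. max (f k t) (MAX k\<in>A. f k t)) absolutely_integrable_on S"
    by (intro absolutely_integrable_max_1) auto
  moreover have "(MAX k\<in>insert k A. f k t) = max (f k t) (MAX k\<in>A. f k t)" for t
    using insert by simp
  ultimately show ?case by simp
qed simp

lemma absolutely_integrable_mult_continuous:
  fixes V \<beta> :: "real \<Rightarrow> real"
  assumes "continuous_on {a..b} V" "\<beta> absolutely_integrable_on {a..b}"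
  shows "(\<lambda>t. \<beta> t * V t) absolutely_integrable_on {a..b}"
proof -
  have "(\<lambda>t. V t * \<beta> t) absolutely_integrable_on {a..b}"
  proof (rule absolutely_integrable_bounded_measurable_product_real)
    show "V \<in> borel_measurable (lebesgue_on {a..b})"
      using assms(1) by (intro continuous_imp_measurable_on_sets_lebesgue) auto
    show "bounded (V ` {a..b})"
      using assms(1) by (intro compact_imp_bounded compact_continuous_image) auto
  qed (use assms in auto)
  then show ?thesis by (simp add: mult.commute)
qed

subsection \<open>Absolute continuity\<close>

lemma ac_on_subset: "ac_on I f \<Longrightarrow> J \<subseteq> I \<Longrightarrow> ac_on J f"
  unfolding ac_on_def by (meson order_trans)

lemma ac_onD:
  assumes "ac_on I f" "0 < e"
  shows "\<exists>\<delta>>0. \<forall>\<D> U. \<D> division_of U \<longrightarrow> U \<subseteq> I \<longrightarrow>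
        (\<Sum>K\<in>\<D>. Sup K - Inf K) < \<delta> \<longrightarrow> (\<Sum>K\<in>\<D>. \<bar>f (Sup K) - f (Inf K)\<bar>) < e"
  by (rule mp[OF spec[OF assms(1)[unfolded ac_on_def]] assms(2)])

text \<open>The domination applies to each interval of a division separately; this covers scaling,
  sign change and the positive part at once.\<close>

lemma ac_on_lipschitz_comp:
  assumes f: "ac_on I f"
    and g: "\<And>s t. s \<in> I \<Longrightarrow> t \<in> I \<Longrightarrow> \<bar>g s - g t\<bar> \<le> C * \<bar>f s - f t\<bar>"
  shows "ac_on I g"
  unfolding ac_on_def
proof (intro allI impI)
  fix e :: real assume "e > 0"
  \<comment> \<open>The given \<open>C\<close> may be zero or negative; the enlarged constant is
    positive, so \<open>e / ?C\<close> is a legitimate tolerance.\<close>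
  let ?C = "\<bar>C\<bar> + 1"
  have "e / ?C > 0" using \<open>e > 0\<close> by simp
  obtain \<delta> where "\<delta> > 0" and \<delta>: "\<forall>\<D> U. \<D> division_of U \<longrightarrow> U \<subseteq> I \<longrightarrow>
      (\<Sum>K\<in>\<D>. Sup K - Inf K) < \<delta> \<longrightarrow> (\<Sum>K\<in>\<D>. \<bar>f (Sup K) - f (Inf K)\<bar>) < e / ?C"
    using ac_onD[OF f \<open>e / ?C > 0\<close>] by (elim exE conjE)
  have "(\<Sum>K\<in>\<D>. \<bar>g (Sup K) - g (Inf K)\<bar>) < e"
    if D: "\<D> division_of U" "U \<subseteq> I" "(\<Sum>K\<in>\<D>. Sup K - Inf K) < \<delta>" for \<D> U
  proof -
    have "(\<Sum>K\<in>\<D>. \<bar>g (Sup K) - g (Inf K)\<bar>) \<le> (\<Sum>K\<in>\<D>. ?C * \<bar>f (Sup K) - f (Inf K)\<bar>)"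
    proof (rule sum_mono)
      fix K assume K: "K \<in> \<D>"
      then obtain u v where uv: "K = {u..v}"
        using division_ofD(4)[OF D(1) K] by auto
      have "K \<noteq> {}" "K \<subseteq> I"
        using division_ofD(2,3)[OF D(1) K] D(2) by auto
      with uv have "Sup K \<in> I" "Inf K \<in> I" by auto
      then have "\<bar>g (Sup K) - g (Inf K)\<bar> \<le> C * \<bar>f (Sup K) - f (Inf K)\<bar>"
        by (rule g)
      also have "\<dots> \<le> ?C * \<bar>f (Sup K) - f (Inf K)\<bar>"
        by (rule mult_right_mono) auto
      finally show "\<bar>g (Sup K) - g (Inf K)\<bar> \<le> ?C * \<bar>f (Sup K) - f (Inf K)\<bar>" .
    qed
    also have "\<dots> = ?C * (\<Sum>K\<in>\<D>. \<bar>f (Sup K) - f (Inf K)\<bar>)"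
      by (simp add: sum_distrib_left)
    also have "\<dots> < ?C * (e / ?C)"
      using \<delta>[rule_format, OF D] by (intro mult_strict_left_mono) auto
    finally show ?thesis by simp
  qed
  then show "\<exists>\<delta>>0. \<forall>\<D> U. \<D> division_of U \<longrightarrow> U \<subseteq> I \<longrightarrow>
        (\<Sum>K\<in>\<D>. Sup K - Inf K) < \<delta> \<longrightarrow> (\<Sum>K\<in>\<D>. \<bar>g (Sup K) - g (Inf K)\<bar>) < e"
    using \<open>\<delta> > 0\<close> by blast
qed

lemma ac_on_mult_left: "ac_on I f \<Longrightarrow> ac_on I (\<lambda>t. c * f t)"
  by (erule ac_on_lipschitz_comp[where C = "\<bar>c\<bar>"]) (metis abs_mult order_refl right_diff_distrib)

lemma ac_on_minus: "ac_on I f \<Longrightarrow> ac_on I (\<lambda>t. - f t)"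
  using ac_on_mult_left[of I f "-1"] by simp

lemma ac_on_max_0: "ac_on I f \<Longrightarrow> ac_on I (\<lambda>t. max (f t) 0)"
  by (rule ac_on_lipschitz_comp[where C = 1]) auto

lemma ac_on_add:
  assumes f: "ac_on I f" and g: "ac_on I g"
  shows "ac_on I (\<lambda>t. f t + g t)"
  unfolding ac_on_def
proof (intro allI impI)
  fix e :: real assume "e > 0"
  then have e2: "e / 2 > 0" by simp
  obtain \<delta>1 where "\<delta>1 > 0" and \<delta>1: "\<forall>\<D> U. \<D> division_of U \<longrightarrow> U \<subseteq> I \<longrightarrow>
      (\<Sum>K\<in>\<D>. Sup K - Inf K) < \<delta>1 \<longrightarrow> (\<Sum>K\<in>\<D>. \<bar>f (Sup K) - f (Inf K)\<bar>) < e / 2"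
    using ac_onD[OF f e2] by (elim exE conjE)
  obtain \<delta>2 where "\<delta>2 > 0" and \<delta>2: "\<forall>\<D> U. \<D> division_of U \<longrightarrow> U \<subseteq> I \<longrightarrow>
      (\<Sum>K\<in>\<D>. Sup K - Inf K) < \<delta>2 \<longrightarrow> (\<Sum>K\<in>\<D>. \<bar>g (Sup K) - g (Inf K)\<bar>) < e / 2"
    using ac_onD[OF g e2] by (elim exE conjE)
  have "(\<Sum>K\<in>\<D>. \<bar>f (Sup K) + g (Sup K) - (f (Inf K) + g (Inf K))\<bar>) < e"
    if D: "\<D> division_of U" "U \<subseteq> I" "(\<Sum>K\<in>\<D>. Sup K - Inf K) < min \<delta>1 \<delta>2" for \<D> U
  proof -
    have "(\<Sum>K\<in>\<D>. \<bar>f (Sup K) + g (Sup K) - (f (Inf K) + g (Inf K))\<bar>)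
        \<le> (\<Sum>K\<in>\<D>. \<bar>f (Sup K) - f (Inf K)\<bar> + \<bar>g (Sup K) - g (Inf K)\<bar>)"
      by (rule sum_mono) simp
    also have "\<dots> < e / 2 + e / 2"
      unfolding sum.distrib using \<delta>1[rule_format, OF D(1,2)] \<delta>2[rule_format, OF D(1,2)] D(3) by simp
    finally show ?thesis by simp
  qed
  then show "\<exists>\<delta>>0. \<forall>\<D> U. \<D> division_of U \<longrightarrow> U \<subseteq> I \<longrightarrow> (\<Sum>K\<in>\<D>. Sup K - Inf K) < \<delta> \<longrightarrow>
      (\<Sum>K\<in>\<D>. \<bar>f (Sup K) + g (Sup K) - (f (Inf K) + g (Inf K))\<bar>) < e"
    using \<open>\<delta>1 > 0\<close> \<open>\<delta>2 > 0\<close> by (intro exI[of _ "min \<delta>1 \<delta>2"]) auto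
qed

lemma ac_on_const: "ac_on I (\<lambda>t. c)"
  unfolding ac_on_def by (auto intro: zero_less_one)

lemma ac_on_sum:
  assumes "\<And>i. i \<in> A \<Longrightarrow> ac_on I (f i)"
  shows "ac_on I (\<lambda>t. \<Sum>i\<in>A. f i t)"
  using assms by (induction A rule: infinite_finite_induct) (auto intro: ac_on_const ac_on_add)

lemma ac_on_imp_continuous_on:
  assumes "ac_on {a..b} f"
  shows "continuous_on {a..b} f"
  unfolding continuous_on_iff
proof (intro ballI allI impI)
  fix x e :: real assume x: "x \<in> {a..b}" and "e > 0"
  obtain \<delta> where "\<delta> > 0" and \<delta>: "\<forall>\<D> U. \<D> division_of U \<longrightarrow> U \<subseteq> {a..b} \<longrightarrow>
      (\<Sum>K\<in>\<D>. Sup K - Inf K) < \<delta> \<longrightarrow> (\<Sum>K\<in>\<D>. \<bar>f (Sup K) - f (Inf K)\<bar>) < e"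
    using ac_onD[OF assms \<open>e > 0\<close>] by (elim exE conjE)
  \<comment> \<open>A single compact interval is a division, so \<open>\<delta>\<close> is a modulus
    of uniform continuity for \<open>e\<close>.\<close>
  have *: "\<bar>f v - f u\<bar> < e" if "u \<le> v" "a \<le> u" "v \<le> b" "v - u < \<delta>" for u v
    using \<delta>[rule_format, of "{{u..v}}" "{u..v}"] that division_of_self[of u v] by (simp add: cbox_interval)
  have "dist (f y) (f x) < e" if "y \<in> {a..b}" "dist y x < \<delta>" for y
    using *[of x y] *[of y x] that x by (cases "x \<le> y") (auto simp: dist_real_def)
  then show "\<exists>d>0. \<forall>x'\<in>{a..b}. dist x' x < d \<longrightarrow> dist (f x') (f x) < e"
    using \<open>\<delta> > 0\<close> by blast
qed

text \<open>A fine tagged division splits by whether the tag lies in \<open>N\<close>. Outside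
  \<open>N\<close>, \<open>straddle\<close> bounds each increment by a term of a Riemann sum of
  \<open>g\<close>; over \<open>N\<close>, the intervals lie in an open set of small measure, where
  absolute continuity makes the total increment small. Only an upper estimate around each point is
  assumed, not a derivative, so that functions with kinks qualify.\<close>

lemma ac_diff_le_integral:
  fixes f g :: "real \<Rightarrow> real"
  assumes ab: "a \<le> b" and ac: "ac_on {a..b} f" and g: "g integrable_on {a..b}" and N: "negligible N"
    and straddle: "\<And>x e. x \<in> {a..b} - N \<Longrightarrow> 0 < e \<Longrightarrow>
      \<exists>\<delta>>0. \<forall>u v. a \<le> u \<longrightarrow> u \<le> x \<longrightarrow> x \<le> v \<longrightarrow> v \<le> b \<longrightarrow> v - u < \<delta> \<longrightarrow>
        f v - f u \<le> (g x + e) * (v - u)"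
  shows "f b - f a \<le> integral {a..b} g"
proof (rule field_le_epsilon)
  fix e0 :: real assume "e0 > 0"
  \<comment> \<open>The error budget: one \<open>e\<close> for the tags in \<open>N\<close>, one for
    the Riemann sum, and \<open>e * (b - a)\<close> for the slack in
    \<open>straddle\<close>.\<close>
  define e where "e = e0 / (b - a + 2)"
  have "e > 0" using \<open>e0 > 0\<close> ab by (simp add: e_def)
  have "e * (b - a + 2) = e0" using ab by (simp add: e_def)
  then have e0: "e * (b - a) + 2 * e = e0" by (simp add: algebra_simps)
  \<comment> \<open>With value 0 on \<open>N\<close>, tags in \<open>N\<close> add nothing to the
    Riemann sum, so the sum over the other tags is the full one.\<close>
  define g' where "g' x = (if x \<in> N then 0 else g x)" for x
  have int: "(g' has_integral integral {a..b} g) {a..b}"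
    by (rule has_integral_spike[OF N _ integrable_integral[OF g]]) (auto simp: g'_def)
  have "\<exists>\<gamma>. gauge \<gamma> \<and> (\<forall>p. p tagged_division_of {a..b} \<and> \<gamma> fine p \<longrightarrow>
      norm ((\<Sum>(x, K)\<in>p. content K *\<^sub>R g' x) - integral {a..b} g) < e)"
    by (rule mp[OF spec[OF int[unfolded has_integral_real]] \<open>e > 0\<close>])
  then obtain \<gamma> where "gauge \<gamma>" and "\<forall>p. p tagged_division_of {a..b} \<and> \<gamma> fine p \<longrightarrow>
      norm ((\<Sum>(x, K)\<in>p. content K *\<^sub>R g' x) - integral {a..b} g) < e"
    by (elim exE conjE)
  then have \<gamma>: "\<bar>(\<Sum>(x, K)\<in>p. content K * g' x) - integral {a..b} g\<bar> < e"
    if "p tagged_division_of {a..b}" "\<gamma> fine p" for p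
    using that by (simp only: real_norm_def real_scaleR_def)
  obtain \<delta> where "\<delta> > 0" and \<delta>: "\<forall>\<D> U. \<D> division_of U \<longrightarrow> U \<subseteq> {a..b} \<longrightarrow>
      (\<Sum>K\<in>\<D>. Sup K - Inf K) < \<delta> \<longrightarrow> (\<Sum>K\<in>\<D>. \<bar>f (Sup K) - f (Inf K)\<bar>) < e"
    using ac_onD[OF ac \<open>e > 0\<close>] by (elim exE conjE)
  \<comment> \<open>The outer open set comes with \<open>G - N\<close> small; as \<open>N\<close> is
    null, \<open>G\<close> itself is small.\<close>
  obtain G where G: "open G" "N \<subseteq> G" "G \<in> lmeasurable" "measure lebesgue G < \<delta>"
  proof -
    have N': "N \<in> null_sets lebesgue"
      using N negligible_iff_null_sets by blast
    then obtain G where G: "open G" "N \<subseteq> G" "G - N \<in> lmeasurable" "emeasure lebesgue (G - N) < ennreal \<delta>"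
      using sets_lebesgue_outer_open[of N \<delta>] \<open>\<delta> > 0\<close> by blast
    have em: "emeasure lebesgue G = emeasure lebesgue (G - N)"
      using emeasure_Diff_null_set[OF N', of G] G(1) by simp
    have "G \<in> lmeasurable"
      using G(4) em \<open>open G\<close> by (intro fmeasurableI) (auto intro: less_trans)
    moreover from this have "measure lebesgue G < \<delta>"
      using G(4) em emeasure_eq_measure2[of G lebesgue] by (simp add: ennreal_less_iff)
    ultimately show ?thesis using that G by blast
  qed
  \<comment> \<open>\<open>Q x d\<close> says that \<open>d\<close> is an admissible gauge radius at
    \<open>x\<close>: inside \<open>N\<close> the ball must stay in \<open>G\<close>, outside
    \<open>N\<close> the straddle estimate must hold up to width \<open>d\<close>.\<close>
  define Q where "Q x d \<longleftrightarrow> 0 < d \<and> (x \<in> {a..b} \<longrightarrow>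
      (if x \<in> N then ball x d \<subseteq> G
       else \<forall>u v. a \<le> u \<longrightarrow> u \<le> x \<longrightarrow> x \<le> v \<longrightarrow> v \<le> b \<longrightarrow> v - u < d \<longrightarrow>
              f v - f u \<le> (g' x + e) * (v - u)))" for x d
  have "\<exists>d. Q x d" for x
  proof (cases "x \<in> {a..b}")
    case x: True
    show ?thesis
    proof (cases "x \<in> N")
      case True
      then obtain d where "d > 0" "ball x d \<subseteq> G"
        using G(1,2) open_contains_ball_eq by blast
      then show ?thesis using True by (auto simp: Q_def)
    next
      case False
      with x have "x \<in> {a..b} - N" by simp
      from straddle[OF this \<open>e > 0\<close>] show ?thesis
        using False by (auto simp: Q_def g'_def)
    qed
  qed (auto simp: Q_def intro: exI[of _ 1])
  then obtain r where Q: "Q x (r x)" for x by metis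
  have r: "r x > 0" for x using Q by (simp add: Q_def)
  have rG: "ball x (r x) \<subseteq> G" if "x \<in> {a..b}" "x \<in> N" for x
    using Q[of x] that by (simp add: Q_def)
  have rf: "f v - f u \<le> (g' x + e) * (v - u)"
    if "x \<in> {a..b}" "x \<notin> N" "a \<le> u" "u \<le> x" "x \<le> v" "v \<le> b" "v - u < r x" for x u v
    using Q[of x] that by (simp add: Q_def)
  \<comment> \<open>Halving the radius keeps the length of an interval, and not only the distance of
    its ends from the tag, below \<open>r x\<close>.\<close>
  have "gauge (\<lambda>x. ball x (r x / 2))"
    using r by (intro gauge_ball_dependent) simp
  then have "gauge (\<lambda>x. \<gamma> x \<inter> ball x (r x / 2))"
    using \<open>gauge \<gamma>\<close> by (intro gauge_Int)
  then obtain p where p: "p tagged_division_of {a..b}" and fine: "(\<lambda>x. \<gamma> x \<inter> ball x (r x / 2)) fine p"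
    by (rule fine_division_exists_real)
  have fin: "finite p" using p by blast
  have mem: "\<exists>u v. K = {u..v} \<and> a \<le> u \<and> u \<le> x \<and> x \<le> v \<and> v \<le> b \<and> x \<in> {a..b} \<and>
       v - u < r x \<and> {u..v} \<subseteq> ball x (r x)" if xK: "(x, K) \<in> p" for x K
  proof -
    obtain u v where uv: "K = {u..v}" using p xK by (metis box_real(2) tagged_division_ofD(4))
    have x: "x \<in> K" "K \<subseteq> {a..b}" using tagged_division_ofD(2,3)[OF p xK] by auto
    have "K \<subseteq> ball x (r x / 2)" using fine xK unfolding fine_def by blast
    moreover have "u \<in> K" "v \<in> K" using uv x by auto
    moreover have "ball x (r x / 2) \<subseteq> ball x (r x)"
      using r[of x] by (intro subset_ball) simp
    ultimately have "u \<in> ball x (r x / 2)" "v \<in> ball x (r x / 2)" "K \<subseteq> ball x (r x)"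
      by blast+
    then show ?thesis using uv x by (auto simp: dist_real_def)
  qed
  define p1 where "p1 = {(x, K). (x, K) \<in> p \<and> x \<in> N}"
  define p2 where "p2 = {(x, K). (x, K) \<in> p \<and> x \<notin> N}"
  have p12: "p = p1 \<union> p2" "p1 \<inter> p2 = {}" "finite p1" "finite p2"
    using fin by (auto simp: p1_def p2_def intro: finite_subset[OF _ fin])
  have "p1 tagged_partial_division_of {a..b}"
    by (rule tagged_partial_division_subset[where s = p])
      (use p p12 in \<open>auto simp: tagged_division_of_def\<close>)
  then have p1: "p1 tagged_division_of (\<Union>(snd ` p1))"
    by (rule tagged_partial_division_of_Union_self)
  have D1: "snd ` p1 division_of (\<Union>(snd ` p1))"
    by (rule division_of_tagged_division[OF p1])
  \<comment> \<open>Absolute continuity speaks of sets of intervals, a tagged division of pairs.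
    Distinct pairs can share only an interval with empty interior; \<open>\<phi>\<close> vanishes
    there, so forgetting the tags preserves the sum. The empty set gets 0 explicitly because its
    \<open>Sup\<close> and \<open>Inf\<close> are unspecified.\<close>
  define \<phi> where "\<phi> K = (if K = {} then 0 else \<bar>f (Sup K) - f (Inf K)\<bar>)" for K
  have "\<phi> (cbox u v) = 0" if "box u v = {}" for u v
    using that by (cases "u = v") (auto simp: \<phi>_def box_real)
  with p1 have "(\<Sum>(x, K)\<in>p1. \<phi> K) = (\<Sum>K\<in>snd ` p1. \<phi> K)"
    by (rule sum.over_tagged_division_lemma)
  moreover have "(\<Sum>(x, K)\<in>p1. f (Sup K) - f (Inf K)) \<le> (\<Sum>(x, K)\<in>p1. \<phi> K)"
  proof (rule sum_mono)
    fix z assume "z \<in> p1"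
    moreover obtain x K where "z = (x, K)" by (cases z)
    ultimately have "x \<in> K" using tagged_division_ofD(2)[OF p1] by blast
    then show "(case z of (x, K) \<Rightarrow> f (Sup K) - f (Inf K)) \<le> (case z of (x, K) \<Rightarrow> \<phi> K)"
      using \<open>z = (x, K)\<close> by (auto simp: \<phi>_def)
  qed
  moreover have "(\<Sum>K\<in>snd ` p1. \<phi> K) \<le> (\<Sum>K\<in>snd ` p1. \<bar>f (Sup K) - f (Inf K)\<bar>)"
    by (intro sum_mono) (simp add: \<phi>_def)
  ultimately have "(\<Sum>(x, K)\<in>p1. f (Sup K) - f (Inf K)) \<le> (\<Sum>K\<in>snd ` p1. \<bar>f (Sup K) - f (Inf K)\<bar>)"
    by linarith
  also have "\<dots> < e"
  proof (rule \<delta>[rule_format, OF D1])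
    show "\<Union>(snd ` p1) \<subseteq> {a..b}"
    proof (rule Union_least)
      fix K assume "K \<in> snd ` p1"
      then obtain x where "(x, K) \<in> p" by (auto simp: p1_def)
      then show "K \<subseteq> {a..b}" by (rule tagged_division_ofD(3)[OF p])
    qed
    have "(\<Sum>K\<in>snd ` p1. Sup K - Inf K) = (\<Sum>K\<in>snd ` p1. content K)"
    proof (rule sum.cong)
      fix K assume "K \<in> snd ` p1"
      then obtain x where "(x, K) \<in> p" unfolding p1_def by auto
      then show "Sup K - Inf K = content K" using mem[of x K] by auto
    qed simp
    also have "\<dots> = (\<Sum>K\<in>snd ` p1. measure lebesgue K)"
    proof (rule sum.cong)
      fix K assume "K \<in> snd ` p1"
      then obtain u v where "K = cbox u v" using division_ofD(4)[OF D1] by blast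
      then show "content K = measure lebesgue K" by (simp add: measure_completion)
    qed simp
    also have "\<dots> = measure lebesgue (\<Union>(snd ` p1))"
      by (rule content_division[OF D1])
    also have "\<dots> \<le> measure lebesgue G"
    proof (rule measure_mono_fmeasurable)
      show "\<Union>(snd ` p1) \<subseteq> G"
      proof (rule Union_least)
        fix K assume "K \<in> snd ` p1"
        then obtain x where "(x, K) \<in> p" "x \<in> N" by (auto simp: p1_def)
        with mem[of x K] have "K \<subseteq> ball x (r x)" "x \<in> {a..b}" by auto
        with rG[of x] \<open>x \<in> N\<close> show "K \<subseteq> G" by blast
      qed
      show "\<Union>(snd ` p1) \<in> sets lebesgue"
        using lmeasurable_division[OF D1] by blast
    qed (fact G)
    also have "\<dots> < \<delta>" by (fact G)
    finally show "(\<Sum>K\<in>snd ` p1. Sup K - Inf K) < \<delta>" .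
  qed
  finally have s1: "(\<Sum>(x, K)\<in>p1. f (Sup K) - f (Inf K)) \<le> e" by simp
  have "(\<Sum>(x, K)\<in>p2. f (Sup K) - f (Inf K)) \<le> (\<Sum>(x, K)\<in>p2. (g' x + e) * content K)"
  proof (rule sum_mono, clarify)
    fix x K assume "(x, K) \<in> p2"
    then have xK: "(x, K) \<in> p" "x \<notin> N" unfolding p2_def by auto
    obtain u v where "K = {u..v}" "a \<le> u" "u \<le> x" "x \<le> v" "v \<le> b" "x \<in> {a..b}" "v - u < r x"
      using mem[OF xK(1)] by blast
    then show "f (Sup K) - f (Inf K) \<le> (g' x + e) * content K"
      using rf[of x u v] xK by simp
  qed
  also have "\<dots> = (\<Sum>(x, K)\<in>p2. content K * g' x) + (\<Sum>(x, K)\<in>p2. e * content K)"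
    by (simp add: sum.distrib[symmetric] split_def algebra_simps)
  also have "(\<Sum>(x, K)\<in>p2. content K * g' x) = (\<Sum>(x, K)\<in>p. content K * g' x)"
    unfolding p12(1) using p12
    by (subst sum.union_disjoint) (auto intro!: sum.neutral simp: p1_def g'_def)
  also have "(\<Sum>(x, K)\<in>p2. e * content K) \<le> (\<Sum>(x, K)\<in>p. e * content K)"
    using \<open>e > 0\<close> p12 by (intro sum_mono2[OF fin]) auto
  also have "(\<Sum>(x, K)\<in>p. e * content K) = e * (\<Sum>(x, K)\<in>p. content K)"
    by (simp add: sum_distrib_left split_def)
  also have "(\<Sum>(x, K)\<in>p. content K) = b - a"
    using additive_content_tagged_division[of p a b] p ab by simp
  also have "(\<Sum>(x, K)\<in>p. content K * g' x) \<le> integral {a..b} g + e"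
  proof -
    have "\<gamma> fine p" using fine unfolding fine_Int by simp
    from \<gamma>[OF p this] show ?thesis by linarith
  qed
  finally have s2: "(\<Sum>(x, K)\<in>p2. f (Sup K) - f (Inf K)) \<le> integral {a..b} g + e + e * (b - a)" by simp
  have "f b - f a = (\<Sum>(x, K)\<in>p. f (Sup K) - f (Inf K))"
    by (rule additive_tagged_division_1[OF ab p, symmetric])
  also have "\<dots> = (\<Sum>(x, K)\<in>p1. f (Sup K) - f (Inf K)) + (\<Sum>(x, K)\<in>p2. f (Sup K) - f (Inf K))"
    unfolding p12(1) using p12 by (intro sum.union_disjoint) auto
  also have "\<dots> \<le> integral {a..b} g + e0"
    using s1 s2 e0 by simp
  finally show "f b - f a \<le> integral {a..b} g + e0" .
qed

subsection \<open>Gronwall inequalities with an integrable coefficient\<close>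

text \<open>The hypothesis is uniform in the position of \<open>u\<close> and \<open>v\<close>, so
  the increments add up over a fine partition, here by bisection; the total error
  \<open>e * (\<Phi> b - \<Phi> a)\<close> vanishes with \<open>e\<close>. This stands in for an
  argument from the sign of a derivative of \<open>F\<close>.\<close>

lemma le_if_locally_almost_le:
  fixes F \<Phi> :: "real \<Rightarrow> real"
  assumes ab: "a \<le> b"
    and loc: "\<And>e. 0 < e \<Longrightarrow> \<exists>\<delta>>0. \<forall>u v. a \<le> u \<longrightarrow> u \<le> v \<longrightarrow> v \<le> b \<longrightarrow> v - u < \<delta> \<longrightarrow>
      F v - F u \<le> e * (\<Phi> v - \<Phi> u)"
  shows "F b \<le> F a"
proof (rule field_le_epsilon)
  fix e0 :: real assume "e0 > 0"
  \<comment> \<open>Adding 1 keeps the divisor positive when the two values of \<open>\<Phi>\<close>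
    agree.\<close>
  define e where "e = e0 / (\<bar>\<Phi> b - \<Phi> a\<bar> + 1)"
  have "e > 0" using \<open>e0 > 0\<close> by (simp add: e_def)
  then obtain \<delta> where "\<delta> > 0" and \<delta>: "\<And>u v. a \<le> u \<Longrightarrow> u \<le> v \<Longrightarrow> v \<le> b \<Longrightarrow> v - u < \<delta> \<Longrightarrow>
      F v - F u \<le> e * (\<Phi> v - \<Phi> u)"
    using loc by meson
  define P where "P u v \<longleftrightarrow> (a \<le> u \<longrightarrow> u \<le> v \<longrightarrow> v \<le> b \<longrightarrow> F v - F u \<le> e * (\<Phi> v - \<Phi> u))" for u v
  have "P a b"
  proof (rule Bolzano[OF ab])
    show "P u w" if "P u v" "P v w" "u \<le> v" "v \<le> w" for u v w
      using that unfolding P_def by (fastforce simp: algebra_simps)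
    show "\<exists>d>0. \<forall>u v. u \<le> x \<and> x \<le> v \<and> v - u < d \<longrightarrow> P u v" for x
      using \<open>\<delta> > 0\<close> \<delta> unfolding P_def by (intro exI[of _ \<delta>]) auto
  qed
  then have "F b - F a \<le> e * (\<Phi> b - \<Phi> a)" using ab by (simp add: P_def)
  also have "\<dots> \<le> e * (\<bar>\<Phi> b - \<Phi> a\<bar> + 1)"
    using \<open>e > 0\<close> by (intro mult_left_mono) auto
  also have "\<dots> = e0" by (simp add: e_def add_pos_pos)
  finally show "F b \<le> F a + e0" by simp
qed

text \<open>Convexity: the graph of \<open>exp\<close> lies above its tangent at \<open>y\<close>.
  Together with the next bound it replaces the chain rule for
  \<open>exp (\<integral> \<beta>)\<close>, with the factor taken at the end point that fits the
  direction of the estimate.\<close>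

lemma exp_diff_le: "exp y - exp x \<le> exp y * (y - x)" for x y :: real
proof -
  have "1 + (x - y) \<le> exp (x - y)" by (rule exp_ge_add_one_self)
  then have "exp y * (1 + (x - y)) \<le> exp y * exp (x - y)" by simp
  then show ?thesis by (simp add: algebra_simps flip: exp_add)
qed

lemma exp_diff_ge: "exp x * (y - x) \<le> exp y - exp x" for x y :: real
  using exp_diff_le[of x y] by (simp add: algebra_simps)

text \<open>The difference is the integral from \<open>u\<close> to \<open>v\<close> of
  \<open>\<beta> t * (V w - V t)\<close>, and uniform continuity makes the bracket smaller than
  \<open>e\<close>. The sample point \<open>w\<close> is left free since the upper Gronwall bound
  uses the left end and the lower one the right end.\<close>

lemma weighted_oscillation_small:
  fixes V \<beta> :: "real \<Rightarrow> real"
  assumes V: "continuous_on {a..b} V" and \<beta>: "\<beta> absolutely_integrable_on {a..b}" and "0 < e"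
  obtains \<delta> where "\<delta> > 0"
    "\<And>u v w. a \<le> u \<Longrightarrow> u \<le> v \<Longrightarrow> v \<le> b \<Longrightarrow> v - u < \<delta> \<Longrightarrow> w \<in> {u..v} \<Longrightarrow>
       \<bar>(integral {a..v} \<beta> - integral {a..u} \<beta>) * V w - integral {u..v} (\<lambda>t. \<beta> t * V t)\<bar>
         \<le> e * (integral {a..v} (\<lambda>t. \<bar>\<beta> t\<bar>) - integral {a..u} (\<lambda>t. \<bar>\<beta> t\<bar>))"
proof -
  have "uniformly_continuous_on {a..b} V"
    using V by (intro compact_uniformly_continuous) auto
  then obtain \<delta> where "\<delta> > 0" and \<delta>: "\<And>s t. s \<in> {a..b} \<Longrightarrow> t \<in> {a..b} \<Longrightarrow> dist s t < \<delta> \<Longrightarrow> dist (V s) (V t) < e"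
    using \<open>0 < e\<close> unfolding uniformly_continuous_on_def by metis
  show ?thesis
  proof (rule that[OF \<open>\<delta> > 0\<close>])
    fix u v w :: real
    assume uv: "a \<le> u" "u \<le> v" "v \<le> b" "v - u < \<delta>" "w \<in> {u..v}"
    have sub: "f integrable_on {s..t}" if "f absolutely_integrable_on {a..b}" "a \<le> s" "t \<le> b"
      for f :: "real \<Rightarrow> real" and s t
    proof -
      have "f integrable_on {a..b}"
        using that(1) by (rule set_lebesgue_integral_eq_integral(1))
      then show ?thesis by (rule integrable_on_subinterval) (use that in auto)
    qed
    have abs\<beta>: "(\<lambda>t. \<bar>\<beta> t\<bar>) absolutely_integrable_on {a..b}"
      using absolutely_integrable_norm[OF \<beta>] by (simp add: o_def)
    have split: "integral {a..v} f - integral {a..u} f = integral {u..v} f"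
      if "f absolutely_integrable_on {a..b}" for f :: "real \<Rightarrow> real"
      using Henstock_Kurzweil_Integration.integral_combine[of a u v f] sub[OF that, of a v] uv by simp
    have i1: "\<beta> integrable_on {u..v}" and i2: "(\<lambda>t. \<beta> t * V t) integrable_on {u..v}"
      and i3: "(\<lambda>t. \<bar>\<beta> t\<bar>) integrable_on {u..v}"
      using uv by (auto intro!: sub \<beta> abs\<beta> absolutely_integrable_mult_continuous V)
    have "(integral {a..v} \<beta> - integral {a..u} \<beta>) * V w - integral {u..v} (\<lambda>t. \<beta> t * V t)
        = integral {u..v} (\<lambda>t. \<beta> t * V w - \<beta> t * V t)"
      unfolding split[OF \<beta>] using i1 i2 integrable_on_mult_left[OF i1] by (subst integral_diff) auto
    also have "\<bar>\<dots>\<bar> \<le> integral {u..v} (\<lambda>t. e * \<bar>\<beta> t\<bar>)"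
      unfolding real_norm_def[symmetric]
    proof (rule integral_norm_bound_integral)
      fix t assume t: "t \<in> {u..v}"
      have "dist (V w) (V t) < e"
        using t uv by (intro \<delta>) (auto simp: dist_real_def)
      then show "norm (\<beta> t * V w - \<beta> t * V t) \<le> e * norm (\<beta> t)"
        unfolding right_diff_distrib[symmetric]
        by (simp add: dist_real_def abs_mult mult.commute[of e] mult_left_mono)
    qed (use i1 i2 i3 in \<open>auto intro!: integrable_diff integrable_on_mult_left integrable_on_mult_right\<close>)
    also have "\<dots> = e * (integral {a..v} (\<lambda>t. \<bar>\<beta> t\<bar>) - integral {a..u} (\<lambda>t. \<bar>\<beta> t\<bar>))"
      unfolding split[OF abs\<beta>] by simp
    finally show "\<bar>(integral {a..v} \<beta> - integral {a..u} \<beta>) * V w - integral {u..v} (\<lambda>t. \<beta> t * V t)\<bar>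
         \<le> e * (integral {a..v} (\<lambda>t. \<bar>\<beta> t\<bar>) - integral {a..u} (\<lambda>t. \<bar>\<beta> t\<bar>))" .
  qed
qed

text \<open>The exponential factor is bounded on the interval by some \<open>M\<close>, so the
  preceding estimate is used with \<open>e / M\<close>. The free point \<open>z\<close> is later the
  right end for the upper bound and the left end for the lower one.\<close>

lemma gronwall_aux:
  fixes V \<beta> :: "real \<Rightarrow> real"
  assumes V: "continuous_on {a..b} V" and \<beta>: "\<beta> absolutely_integrable_on {a..b}" and "0 < e"
  obtains \<delta> where "\<delta> > 0"
    "\<And>u v w z. a \<le> u \<Longrightarrow> u \<le> v \<Longrightarrow> v \<le> b \<Longrightarrow> v - u < \<delta> \<Longrightarrow> w \<in> {u..v} \<Longrightarrow> z \<in> {u..v} \<Longrightarrow>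
       exp (integral {a..z} \<beta>) *
       \<bar>(integral {a..v} \<beta> - integral {a..u} \<beta>) * V w - integral {u..v} (\<lambda>t. \<beta> t * V t)\<bar>
         \<le> e * (integral {a..v} (\<lambda>t. \<bar>\<beta> t\<bar>) - integral {a..u} (\<lambda>t. \<bar>\<beta> t\<bar>))"
proof -
  have "\<beta> integrable_on {a..b}"
    using \<beta> by (rule set_lebesgue_integral_eq_integral(1))
  then have "continuous_on {a..b} (\<lambda>t. exp (integral {a..t} \<beta>))"
    by (intro continuous_intros indefinite_integral_continuous_1)
  then have "bounded ((\<lambda>t. exp (integral {a..t} \<beta>)) ` {a..b})"
    by (intro compact_imp_bounded compact_continuous_image) auto
  then obtain M where "M > 0" and M: "\<And>t. t \<in> {a..b} \<Longrightarrow> exp (integral {a..t} \<beta>) \<le> M"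
    unfolding bounded_pos by (auto simp: image_iff) 
  have "e / M > 0" using \<open>0 < e\<close> \<open>M > 0\<close> by simp
  then obtain \<delta> where "\<delta> > 0" and \<delta>: "\<And>u v w. a \<le> u \<Longrightarrow> u \<le> v \<Longrightarrow> v \<le> b \<Longrightarrow> v - u < \<delta> \<Longrightarrow> w \<in> {u..v} \<Longrightarrow>
       \<bar>(integral {a..v} \<beta> - integral {a..u} \<beta>) * V w - integral {u..v} (\<lambda>t. \<beta> t * V t)\<bar>
         \<le> e / M * (integral {a..v} (\<lambda>t. \<bar>\<beta> t\<bar>) - integral {a..u} (\<lambda>t. \<bar>\<beta> t\<bar>))"
    using weighted_oscillation_small[OF V \<beta>] by blast
  show ?thesis
  proof (rule that[OF \<open>\<delta> > 0\<close>])
    fix u v w z :: real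
    assume uv: "a \<le> u" "u \<le> v" "v \<le> b" "v - u < \<delta>" "w \<in> {u..v}" and z: "z \<in> {u..v}"
    have "exp (integral {a..z} \<beta>) *
       \<bar>(integral {a..v} \<beta> - integral {a..u} \<beta>) * V w - integral {u..v} (\<lambda>t. \<beta> t * V t)\<bar>
      \<le> M * (e / M * (integral {a..v} (\<lambda>t. \<bar>\<beta> t\<bar>) - integral {a..u} (\<lambda>t. \<bar>\<beta> t\<bar>)))"
      using \<delta>[OF uv] M[of z] z uv \<open>M > 0\<close> by (intro mult_mono) auto
    then show "exp (integral {a..z} \<beta>) *
       \<bar>(integral {a..v} \<beta> - integral {a..u} \<beta>) * V w - integral {u..v} (\<lambda>t. \<beta> t * V t)\<bar>
         \<le> e * (integral {a..v} (\<lambda>t. \<bar>\<beta> t\<bar>) - integral {a..u} (\<lambda>t. \<bar>\<beta> t\<bar>))"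
      using \<open>M > 0\<close> by simp
  qed
qed

text \<open>The product \<open>exp (\<integral> \<beta>) * V\<close> is compared at nearby points by
  a discrete product rule. Its two first-order terms, the increment of
  \<open>\<integral> \<beta>\<close> times \<open>V u\<close> and the integral of
  \<open>\<beta> * V\<close>, cancel up to the oscillation error. The sign of \<open>\<beta>\<close>
  is arbitrary.\<close>

lemma gronwall_upper:
  fixes V \<beta> :: "real \<Rightarrow> real"
  assumes ab: "a \<le> b" and V: "continuous_on {a..b} V" and \<beta>: "\<beta> absolutely_integrable_on {a..b}"
    and V0: "\<And>t. t \<in> {a..b} \<Longrightarrow> 0 \<le> V t"
    and le: "\<And>s t. a \<le> s \<Longrightarrow> s \<le> t \<Longrightarrow> t \<le> b \<Longrightarrow> V t - V s \<le> - integral {s..t} (\<lambda>r. \<beta> r * V r)"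
  shows "V b \<le> exp (- integral {a..b} \<beta>) * V a"
proof -
  let ?B = "\<lambda>t. integral {a..t} \<beta>" and ?\<Phi> = "\<lambda>t. integral {a..t} (\<lambda>t. \<bar>\<beta> t\<bar>)"
  have "exp (?B b) * V b \<le> exp (?B a) * V a"
  proof (rule le_if_locally_almost_le[OF ab, where \<Phi> = ?\<Phi>])
    fix e :: real assume "e > 0"
    then obtain \<delta> where "\<delta> > 0" and \<delta>: "\<And>u v w z. a \<le> u \<Longrightarrow> u \<le> v \<Longrightarrow> v \<le> b \<Longrightarrow> v - u < \<delta> \<Longrightarrow>
       w \<in> {u..v} \<Longrightarrow> z \<in> {u..v} \<Longrightarrow>
       exp (?B z) * \<bar>(?B v - ?B u) * V w - integral {u..v} (\<lambda>t. \<beta> t * V t)\<bar> \<le> e * (?\<Phi> v - ?\<Phi> u)"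
      by (rule gronwall_aux[OF V \<beta>]) (rule that; blast)
    have "exp (?B v) * V v - exp (?B u) * V u \<le> e * (?\<Phi> v - ?\<Phi> u)"
      if uv: "a \<le> u" "u \<le> v" "v \<le> b" "v - u < \<delta>" for u v
    proof -
      have "exp (?B v) * V v - exp (?B u) * V u
          = exp (?B v) * (V v - V u) + (exp (?B v) - exp (?B u)) * V u"
        by (simp add: algebra_simps)
      \<comment> \<open>The increment of the exponential is replaced by its tangent bound, which is
        where \<open>V u\<close> must be nonnegative.\<close>
      also have "\<dots> \<le> exp (?B v) * (- integral {u..v} (\<lambda>t. \<beta> t * V t)) + exp (?B v) * (?B v - ?B u) * V u"
        using le[of u v] V0[of u] uv exp_diff_le by (intro add_mono mult_left_mono mult_right_mono) auto
      also have "\<dots> = exp (?B v) * ((?B v - ?B u) * V u - integral {u..v} (\<lambda>t. \<beta> t * V t))"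
        by (simp add: algebra_simps)
      also have "\<dots> \<le> exp (?B v) * \<bar>(?B v - ?B u) * V u - integral {u..v} (\<lambda>t. \<beta> t * V t)\<bar>"
        by (intro mult_left_mono) auto
      also have "\<dots> \<le> e * (?\<Phi> v - ?\<Phi> u)"
        using uv by (intro \<delta>) auto
      finally show ?thesis .
    qed
    then show "\<exists>\<delta>>0. \<forall>u v. a \<le> u \<longrightarrow> u \<le> v \<longrightarrow> v \<le> b \<longrightarrow> v - u < \<delta> \<longrightarrow>
      exp (?B v) * V v - exp (?B u) * V u \<le> e * (?\<Phi> v - ?\<Phi> u)"
      using \<open>\<delta> > 0\<close> by blast
  qed
  then have "exp (- ?B b) * (exp (?B b) * V b) \<le> exp (- ?B b) * V a" by simp
  then show ?thesis by (simp add: mult.assoc[symmetric] exp_add[symmetric])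
qed

text \<open>The product is expanded with the roles of the end points exchanged: \<open>exp\<close>
  is taken at \<open>u\<close> and \<open>V\<close> at \<open>v\<close>, because \<open>exp\<close>
  now has to be bounded from below by its tangent at \<open>u\<close>.\<close>

lemma gronwall_lower:
  fixes V \<beta> :: "real \<Rightarrow> real"
  assumes ab: "a \<le> b" and V: "continuous_on {a..b} V" and \<beta>: "\<beta> absolutely_integrable_on {a..b}"
    and V0: "\<And>t. t \<in> {a..b} \<Longrightarrow> 0 \<le> V t"
    and ge: "\<And>s t. a \<le> s \<Longrightarrow> s \<le> t \<Longrightarrow> t \<le> b \<Longrightarrow> - integral {s..t} (\<lambda>r. \<beta> r * V r) \<le> V t - V s"
  shows "exp (- integral {a..b} \<beta>) * V a \<le> V b"
proof -
  let ?B = "\<lambda>t. integral {a..t} \<beta>" and ?\<Phi> = "\<lambda>t. integral {a..t} (\<lambda>t. \<bar>\<beta> t\<bar>)"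
  have "- (exp (?B b) * V b) \<le> - (exp (?B a) * V a)"
  proof (rule le_if_locally_almost_le[OF ab, where \<Phi> = ?\<Phi>])
    fix e :: real assume "e > 0"
    then obtain \<delta> where "\<delta> > 0" and \<delta>: "\<And>u v w z. a \<le> u \<Longrightarrow> u \<le> v \<Longrightarrow> v \<le> b \<Longrightarrow> v - u < \<delta> \<Longrightarrow>
       w \<in> {u..v} \<Longrightarrow> z \<in> {u..v} \<Longrightarrow>
       exp (?B z) * \<bar>(?B v - ?B u) * V w - integral {u..v} (\<lambda>t. \<beta> t * V t)\<bar> \<le> e * (?\<Phi> v - ?\<Phi> u)"
      by (rule gronwall_aux[OF V \<beta>]) (rule that; blast)
    have "- (exp (?B v) * V v) - - (exp (?B u) * V u) \<le> e * (?\<Phi> v - ?\<Phi> u)"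
      if uv: "a \<le> u" "u \<le> v" "v \<le> b" "v - u < \<delta>" for u v
    proof -
      have "exp (?B u) * (- integral {u..v} (\<lambda>t. \<beta> t * V t)) + exp (?B u) * (?B v - ?B u) * V v
          \<le> exp (?B u) * (V v - V u) + (exp (?B v) - exp (?B u)) * V v"
        using ge[of u v] V0[of v] uv exp_diff_ge by (intro add_mono mult_left_mono mult_right_mono) auto
      then have "- (exp (?B v) * V v) - - (exp (?B u) * V u)
          \<le> exp (?B u) * - ((?B v - ?B u) * V v - integral {u..v} (\<lambda>t. \<beta> t * V t))"
        by (simp add: algebra_simps)
      also have "\<dots> \<le> exp (?B u) * \<bar>(?B v - ?B u) * V v - integral {u..v} (\<lambda>t. \<beta> t * V t)\<bar>"
        by (intro mult_left_mono) auto
      also have "\<dots> \<le> e * (?\<Phi> v - ?\<Phi> u)"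
        using uv by (intro \<delta>) auto
      finally show ?thesis .
    qed
    then show "\<exists>\<delta>>0. \<forall>u v. a \<le> u \<longrightarrow> u \<le> v \<longrightarrow> v \<le> b \<longrightarrow> v - u < \<delta> \<longrightarrow>
      - (exp (?B v) * V v) - - (exp (?B u) * V u) \<le> e * (?\<Phi> v - ?\<Phi> u)"
      using \<open>\<delta> > 0\<close> by blast
  qed
  then have "exp (- ?B b) * V a \<le> exp (- ?B b) * (exp (?B b) * V b)" by simp
  then show ?thesis by (simp add: mult.assoc[symmetric] exp_add[symmetric])
qed

section \<open>Local increment estimates at a point of differentiability\<close>

lemma has_real_derivative_straddle:
  fixes f :: "real \<Rightarrow> real"
  assumes "(f has_real_derivative c) (at x within {a..b})" "x \<in> {a..b}" "0 < e"
  obtains \<delta> where "\<delta> > 0"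
    "\<And>u v. a \<le> u \<Longrightarrow> u \<le> x \<Longrightarrow> x \<le> v \<Longrightarrow> v \<le> b \<Longrightarrow> v - u < \<delta> \<Longrightarrow>
       \<bar>f v - f u - c * (v - u)\<bar> \<le> e * (v - u)"
proof -
  have "(f has_derivative (*) c) (at x within {a..b})"
    using assms(1) by (simp add: has_field_derivative_def)
  then obtain \<delta> where "\<delta> > 0" and \<delta>: "\<And>y. y \<in> {a..b} \<Longrightarrow> \<bar>y - x\<bar> < \<delta> \<Longrightarrow>
      \<bar>f y - f x - c * (y - x)\<bar> \<le> e * \<bar>y - x\<bar>"
    unfolding has_derivative_within_alt using \<open>0 < e\<close> by (auto simp: real_norm_def)
  show ?thesis
  proof (rule that[OF \<open>\<delta> > 0\<close>])
    fix u v assume uv: "a \<le> u" "u \<le> x" "x \<le> v" "v \<le> b" "v - u < \<delta>"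
    \<comment> \<open>The point \<open>x\<close> lies between \<open>u\<close> and \<open>v\<close>,
      so the errors of the two one-sided estimates add up to \<open>e * (v - u)\<close>.\<close>
    have 1: "\<bar>f v - f x - c * (v - x)\<bar> \<le> e * (v - x)"
      using \<delta>[of v] uv by auto
    have 2: "\<bar>f u - f x - c * (u - x)\<bar> \<le> e * (x - u)"
      using \<delta>[of u] uv by auto
    show "\<bar>f v - f u - c * (v - u)\<bar> \<le> e * (v - u)"
      using 1 2 by (simp add: algebra_simps abs_le_iff)
  qed
qed

text \<open>At a zero of \<open>f\<close> with nonzero derivative, the positive part has a kink, but the estimate
  from above survives: left of the kink the positive part can only make the increment smaller.\<close>

lemma pos_part_straddle:
  fixes f :: "real \<Rightarrow> real"
  assumes f: "(f has_real_derivative c) (at x within {a..b})" and x: "x \<in> {a..b}" and "0 < e"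
    and c: "0 \<le> f x \<Longrightarrow> c \<le> g" and g: "f x \<le> 0 \<Longrightarrow> 0 \<le> g"
  shows "\<exists>\<delta>>0. \<forall>u v. a \<le> u \<longrightarrow> u \<le> x \<longrightarrow> x \<le> v \<longrightarrow> v \<le> b \<longrightarrow> v - u < \<delta> \<longrightarrow>
        max (f v) 0 - max (f u) 0 \<le> (g + e) * (v - u)"
proof -
  obtain \<delta>1 where "\<delta>1 > 0" and \<delta>1: "\<And>u v. a \<le> u \<Longrightarrow> u \<le> x \<Longrightarrow> x \<le> v \<Longrightarrow> v \<le> b \<Longrightarrow> v - u < \<delta>1 \<Longrightarrow>
       \<bar>f v - f u - c * (v - u)\<bar> \<le> e * (v - u)"
    using has_real_derivative_straddle[OF f x \<open>0 < e\<close>] by metis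
  \<comment> \<open>Where \<open>f x\<close> is not zero, \<open>\<delta>2\<close> keeps the sign of
    \<open>f\<close> constant near \<open>x\<close>, so the positive part is there either
    \<open>f\<close> or 0; for \<open>f x = 0\<close> any positive value will do.\<close>
  obtain \<delta>2 where "\<delta>2 > 0" and \<delta>2: "\<And>y. f x \<noteq> 0 \<Longrightarrow> y \<in> {a..b} \<Longrightarrow> \<bar>y - x\<bar> < \<delta>2 \<Longrightarrow> \<bar>f y - f x\<bar> < \<bar>f x\<bar>"
  proof (cases "f x = 0")
    case False
    have "continuous (at x within {a..b}) f"
      using f by (rule DERIV_continuous)
    then show ?thesis
      using that False unfolding continuous_within_eps_delta dist_real_def
      by (metis zero_less_abs_iff)
  qed (use that[of 1] in auto)
  have "max (f v) 0 - max (f u) 0 \<le> (g + e) * (v - u)"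
    if uv: "a \<le> u" "u \<le> x" "x \<le> v" "v \<le> b" "v - u < min \<delta>1 \<delta>2" for u v
  proof -
    consider "f x > 0" | "f x < 0" | "f x = 0" by linarith
    then show ?thesis
    proof cases
      case 1
      have "\<bar>f u - f x\<bar> < \<bar>f x\<bar>" "\<bar>f v - f x\<bar> < \<bar>f x\<bar>"
        using 1 uv x by (intro \<delta>2; force)+
      then have "max (f v) 0 - max (f u) 0 = f v - f u" using 1 by simp
      also have "\<dots> \<le> (c + e) * (v - u)"
        using \<delta>1[of u v] uv by (simp add: algebra_simps abs_le_iff)
      also have "\<dots> \<le> (g + e) * (v - u)"
        using c 1 uv by (intro mult_right_mono) auto
      finally show ?thesis .
    next
      case 2
      have "\<bar>f u - f x\<bar> < \<bar>f x\<bar>" "\<bar>f v - f x\<bar> < \<bar>f x\<bar>"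
        using 2 uv x by (intro \<delta>2; force)+
      then have "max (f v) 0 - max (f u) 0 = 0" using 2 by simp
      also have "\<dots> \<le> (g + e) * (v - u)"
        using g 2 uv \<open>0 < e\<close> by (intro mult_nonneg_nonneg) auto
      finally show ?thesis .
    next
      case 3
      have "f v \<le> (c + e) * (v - x)"
        using \<delta>1[of x v] uv 3 by (simp add: algebra_simps abs_le_iff)
      also have "\<dots> \<le> (g + e) * (v - x)"
        using c 3 uv by (intro mult_right_mono) auto
      also have "\<dots> \<le> (g + e) * (v - u)"
        using g 3 uv \<open>0 < e\<close> by (intro mult_left_mono) auto
      finally have "f v \<le> (g + e) * (v - u)" .
      moreover have "0 \<le> (g + e) * (v - u)"
        using g 3 uv \<open>0 < e\<close> by (intro mult_nonneg_nonneg) auto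
      ultimately show ?thesis by simp
    qed
  qed
  then show ?thesis
    using \<open>\<delta>1 > 0\<close> \<open>\<delta>2 > 0\<close> by (intro exI[of _ "min \<delta>1 \<delta>2"]) auto
qed

subsection \<open>Cooperative linear systems\<close>

text \<open>One null set \<open>N\<close> collects the exceptional times of the equation and of the
  sign condition. The estimates below concern time \<open>b\<close>; the same system stopped
  earlier, as given by \<open>restrict\<close>, yields them at intermediate times.\<close>

locale cooperative_system =
  fixes n :: nat and h :: "nat \<Rightarrow> nat \<Rightarrow> real \<Rightarrow> real" and x :: "nat \<Rightarrow> real \<Rightarrow> real"
    and N :: "real set" and b :: real
  assumes b: "0 \<le> b"
    and h_int: "\<And>i j. i < n \<Longrightarrow> j < n \<Longrightarrow> h i j absolutely_integrable_on {0..b}"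
    and x_ac: "\<And>i. i < n \<Longrightarrow> ac_on {0..b} (x i)"
    and N: "negligible N"
    and h_nonneg: "\<And>i j t. t \<in> {0..b} - N \<Longrightarrow> i < n \<Longrightarrow> j < n \<Longrightarrow> i \<noteq> j \<Longrightarrow> 0 \<le> h i j t"
    and x_deriv: "\<And>i t. t \<in> {0..b} - N \<Longrightarrow> i < n \<Longrightarrow>
      (x i has_real_derivative (\<Sum>j<n. h i j t * x j t)) (at t within {0..b})"
begin

lemma uminus_system: "cooperative_system n h (\<lambda>i t. - x i t) N b"
  by unfold_locales
    (use b h_int x_ac N h_nonneg DERIV_minus[OF x_deriv] in
      \<open>auto intro!: ac_on_minus simp: sum_negf\<close>)

lemma x_deriv_subset:
  assumes "t \<in> {u..v} - N" "0 \<le> u" "v \<le> b" "i < n"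
  shows "(x i has_real_derivative (\<Sum>j<n. h i j t * x j t)) (at t within {u..v})"
  by (rule DERIV_subset[OF x_deriv]) (use assms in auto)

lemma mult_integrable:
  fixes \<beta> y :: "real \<Rightarrow> real"
  assumes "\<beta> absolutely_integrable_on {0..b}" "continuous_on {0..b} y" "0 \<le> u" "v \<le> b"
  shows "(\<lambda>t. \<beta> t * y t) integrable_on {u..v}"
proof -
  have "(\<lambda>t. \<beta> t * y t) absolutely_integrable_on {0..b}"
    using assms(2,1) by (rule absolutely_integrable_mult_continuous)
  then have "(\<lambda>t. \<beta> t * y t) absolutely_integrable_on {u..v}"
    by (rule absolutely_integrable_on_subinterval) (use assms in auto)
  then show ?thesis by (rule set_lebesgue_integral_eq_integral(1))
qed

lemma h_mult_integrable:
  assumes "continuous_on {0..b} y" "0 \<le> u" "v \<le> b" "i < n" "j < n"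
  shows "(\<lambda>t. h i j t * y t) integrable_on {u..v}"
  using assms by (intro mult_integrable h_int)

text \<open>The increments of each positive part are at most the integral of its row of
  \<open>h\<close> applied to all positive parts: replacing the other coordinates by their positive
  parts only enlarges the right-hand side, since off-diagonal entries are nonnegative. Summing over
  the rows leaves the column sums, which \<open>col\<close> bounds, and the upper Gronwall
  inequality applies.\<close>

lemma sum_pos_part_le:
  assumes \<beta>: "\<beta> absolutely_integrable_on {0..b}"
    and col: "\<And>t j. t \<in> {0..b} - N \<Longrightarrow> j < n \<Longrightarrow> (\<Sum>i<n. h i j t) \<le> - \<beta> t"
  shows "(\<Sum>i<n. max (x i b) 0) \<le> exp (- integral {0..b} \<beta>) * (\<Sum>i<n. max (x i 0) 0)"
proof (rule gronwall_upper[OF b _ \<beta>])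
  let ?m = "\<lambda>i t. max (x i t) 0"
  have m_ac: "ac_on {0..b} (?m i)" if "i < n" for i
    using x_ac[OF that] by (rule ac_on_max_0)
  then have m_cont: "continuous_on {0..b} (?m i)" if "i < n" for i
    using that ac_on_imp_continuous_on by blast
  show V_cont: "continuous_on {0..b} (\<lambda>t. \<Sum>i<n. ?m i t)"
    using m_cont by (intro continuous_on_sum) auto
  show "0 \<le> (\<Sum>i<n. ?m i t)" for t by (intro sum_nonneg) auto
  fix s t :: real assume st: "0 \<le> s" "s \<le> t" "t \<le> b"
  let ?g = "\<lambda>i r. \<Sum>j<n. h i j r * ?m j r"
  have g_int: "?g i integrable_on {s..t}" if "i < n" for i
    using st that m_cont by (intro integrable_sum h_mult_integrable) auto
  have step: "?m i t - ?m i s \<le> integral {s..t} (?g i)" if i: "i < n" for i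
  proof (rule ac_diff_le_integral[OF \<open>s \<le> t\<close> _ g_int[OF i] N])
    show "ac_on {s..t} (?m i)"
      using m_ac[OF i] by (rule ac_on_subset) (use st in auto)
    fix r e :: real assume r: "r \<in> {s..t} - N" and "0 < e"
    have rb: "r \<in> {0..b} - N" using r st by auto
    have off: "0 \<le> h i j r * ?m j r" if "j < n" "j \<noteq> i" for j
      using h_nonneg[OF rb i, of j] that by (intro mult_nonneg_nonneg) auto
    show "\<exists>\<delta>>0. \<forall>u v. s \<le> u \<longrightarrow> u \<le> r \<longrightarrow> r \<le> v \<longrightarrow> v \<le> t \<longrightarrow> v - u < \<delta> \<longrightarrow>
        ?m i v - ?m i u \<le> (?g i r + e) * (v - u)"
    proof (rule pos_part_straddle[OF x_deriv_subset[OF r _ _ i] _ \<open>0 < e\<close>])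
      \<comment> \<open>Here the diagonal entry, of unknown sign, multiplies the same number on both
        sides, since \<open>x i r\<close> equals its positive part.\<close>
      assume "0 \<le> x i r"
      show "(\<Sum>j<n. h i j r * x j r) \<le> ?g i r"
      proof (rule sum_mono)
        fix j assume "j \<in> {..<n}"
        then show "h i j r * x j r \<le> h i j r * ?m j r"
          using h_nonneg[OF rb i, of j] \<open>0 \<le> x i r\<close> by (cases "j = i") (auto intro: mult_left_mono)
      qed
    next
      \<comment> \<open>Here the diagonal term vanishes, and the off-diagonal terms are
        nonnegative.\<close>
      assume "x i r \<le> 0"
      then have "0 \<le> h i j r * ?m j r" if "j < n" for j
        using off[OF that] by (cases "j = i") auto
      then show "0 \<le> ?g i r" by (intro sum_nonneg) auto
    qed (use st r in auto)
  qed
  have "(\<Sum>i<n. ?m i t) - (\<Sum>i<n. ?m i s) = (\<Sum>i<n. ?m i t - ?m i s)"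
    by (simp add: sum_subtractf)
  also have "\<dots> \<le> (\<Sum>i<n. integral {s..t} (?g i))"
    using step by (intro sum_mono) auto
  also have "\<dots> = integral {s..t} (\<lambda>r. \<Sum>i<n. ?g i r)"
    using g_int by (intro integral_sum[symmetric]) auto
  also have "\<dots> \<le> integral {s..t} (\<lambda>r. - (\<beta> r * (\<Sum>i<n. ?m i r)))"
  proof (rule integral_le_negligible[OF _ _ N])
    show "(\<lambda>r. \<Sum>i<n. ?g i r) integrable_on {s..t}"
      by (rule integrable_sum) (use g_int in auto)
    show "(\<lambda>r. - (\<beta> r * (\<Sum>i<n. ?m i r))) integrable_on {s..t}"
      by (intro integrable_neg mult_integrable \<beta> V_cont st)
    fix r assume "r \<in> {s..t} - N"
    then have rb: "r \<in> {0..b} - N" using st by auto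
    have "(\<Sum>i<n. ?g i r) = (\<Sum>j<n. (\<Sum>i<n. h i j r) * ?m j r)"
      unfolding sum_distrib_right by (rule sum.swap)
    also have "\<dots> \<le> (\<Sum>j<n. - \<beta> r * ?m j r)"
      using col[OF rb] by (intro sum_mono mult_right_mono) auto
    finally show "(\<Sum>i<n. ?g i r) \<le> - (\<beta> r * (\<Sum>i<n. ?m i r))"
      by (simp add: sum_distrib_left sum_negf)
  qed
  finally show "(\<Sum>i<n. ?m i t) - (\<Sum>i<n. ?m i s) \<le> - integral {s..t} (\<lambda>r. \<beta> r * (\<Sum>i<n. ?m i r))"
    by simp
qed

lemma sum_abs_le:
  assumes "\<beta> absolutely_integrable_on {0..b}"
    and "\<And>t j. t \<in> {0..b} - N \<Longrightarrow> j < n \<Longrightarrow> (\<Sum>i<n. h i j t) \<le> - \<beta> t"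
  shows "(\<Sum>i<n. \<bar>x i b\<bar>) \<le> exp (- integral {0..b} \<beta>) * (\<Sum>i<n. \<bar>x i 0\<bar>)"
proof -
  have abs: "(\<Sum>i<n. \<bar>y i\<bar>) = (\<Sum>i<n. max (y i) 0) + (\<Sum>i<n. max (- y i) 0)" for y :: "nat \<Rightarrow> real"
    unfolding sum.distrib[symmetric] by (rule sum.cong) auto
  show ?thesis
    unfolding abs distrib_left
    using sum_pos_part_le[OF assms] cooperative_system.sum_pos_part_le[OF uminus_system assms]
    by (intro add_mono)
qed

text \<open>Minus the sum of all absolute entries is a crude rate that always satisfies the column
  condition. It suffices: the negative parts vanish at time 0, so any exponential factor leaves the
  bound 0 at time \<open>b\<close>.\<close>

lemma nonneg_preserved:
  assumes init: "\<And>i. i < n \<Longrightarrow> 0 \<le> x i 0" and "i < n"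
  shows "0 \<le> x i b"
proof -
  let ?\<beta> = "\<lambda>t. - (\<Sum>i<n. \<Sum>j<n. \<bar>h i j t\<bar>)"
  have "(\<lambda>t. \<bar>h i j t\<bar>) absolutely_integrable_on {0..b}" if "i < n" "j < n" for i j
    using absolutely_integrable_norm[OF h_int[OF that]] by (simp add: o_def)
  then have "(\<lambda>t. \<Sum>i<n. \<Sum>j<n. \<bar>h i j t\<bar>) absolutely_integrable_on {0..b}"
    by (intro absolutely_integrable_sum) auto
  then have "?\<beta> absolutely_integrable_on {0..b}"
    using set_integrable_mult_right[of "-1::real"] by fastforce
  moreover have "(\<Sum>i<n. h i j t) \<le> - ?\<beta> t" if "j < n" for j t
  proof -
    have "h i j t \<le> (\<Sum>j<n. \<bar>h i j t\<bar>)" if "i < n" for i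
      using member_le_sum[of j "{..<n}" "\<lambda>j. \<bar>h i j t\<bar>"] \<open>j < n\<close> by simp
    then have "(\<Sum>i<n. h i j t) \<le> (\<Sum>i<n. \<Sum>j<n. \<bar>h i j t\<bar>)"
      by (intro sum_mono) auto
    then show ?thesis by simp
  qed
  ultimately have "(\<Sum>i<n. max (- x i b) 0) \<le> exp (- integral {0..b} ?\<beta>) * (\<Sum>i<n. max (- x i 0) 0)"
    by (intro cooperative_system.sum_pos_part_le[OF uminus_system])
  also have "(\<Sum>i<n. max (- x i 0) 0) = 0"
    using init by (intro sum.neutral) auto
  finally have "(\<Sum>i<n. max (- x i b) 0) \<le> 0" by simp
  moreover have "max (- x i b) 0 \<le> (\<Sum>i<n. max (- x i b) 0)"
    using \<open>i < n\<close> by (intro member_le_sum) auto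
  ultimately show ?thesis by simp
qed

lemma restrict:
  assumes "c \<in> {0..b}"
  shows "cooperative_system n h x N c"
proof
  show "h i j absolutely_integrable_on {0..c}" if "i < n" "j < n" for i j
    using h_int[OF that] by (rule absolutely_integrable_on_subinterval) (use assms in auto)
  show "ac_on {0..c} (x i)" if "i < n" for i
    using x_ac[OF that] by (rule ac_on_subset) (use assms in auto)
  show "(x i has_real_derivative (\<Sum>j<n. h i j t * x j t)) (at t within {0..c})"
    if "t \<in> {0..c} - N" "i < n" for i t
    using that assms by (intro x_deriv_subset) auto
qed (use assms N h_nonneg in auto)

text \<open>The coordinates stay nonnegative at every intermediate time, so the lower bound on the
  column sums may be multiplied by \<open>x j\<close>; the plain sum then obeys the reversed
  integral inequality.\<close>

lemma sum_ge:
  assumes \<beta>: "\<beta> absolutely_integrable_on {0..b}"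
    and col: "\<And>t j. t \<in> {0..b} - N \<Longrightarrow> j < n \<Longrightarrow> - \<beta> t \<le> (\<Sum>i<n. h i j t)"
    and init: "\<And>i. i < n \<Longrightarrow> 0 \<le> x i 0"
  shows "exp (- integral {0..b} \<beta>) * (\<Sum>i<n. x i 0) \<le> (\<Sum>i<n. x i b)"
proof (rule gronwall_lower[OF b _ \<beta>])
  have x0: "0 \<le> x i t" if "t \<in> {0..b}" "i < n" for i t
    using cooperative_system.nonneg_preserved[OF restrict[OF that(1)]] init that(2) by blast
  have x_cont: "continuous_on {0..b} (x i)" if "i < n" for i
    using x_ac[OF that] by (rule ac_on_imp_continuous_on)
  show V_cont: "continuous_on {0..b} (\<lambda>t. \<Sum>i<n. x i t)"
    using x_cont by (intro continuous_on_sum) auto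
  show "0 \<le> (\<Sum>i<n. x i t)" if "t \<in> {0..b}" for t
    using x0[OF that] by (intro sum_nonneg) auto
  fix s t :: real assume st: "0 \<le> s" "s \<le> t" "t \<le> b"
  \<comment> \<open>The increment lemma bounds from above, so it is applied to \<open>- x i\<close>
    to bound the increments of \<open>x i\<close> from below.\<close>
  let ?g = "\<lambda>i r. - (\<Sum>j<n. h i j r * x j r)"
  have g_int: "?g i integrable_on {s..t}" if "i < n" for i
    using st that x_cont by (intro integrable_neg integrable_sum h_mult_integrable) auto
  have step: "- x i t - - x i s \<le> integral {s..t} (?g i)" if i: "i < n" for i
  proof (rule ac_diff_le_integral[OF \<open>s \<le> t\<close> _ g_int[OF i] N])
    show "ac_on {s..t} (\<lambda>t. - x i t)"
      using x_ac[OF i] by (intro ac_on_minus) (rule ac_on_subset, use st in auto)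
    fix r e :: real assume r: "r \<in> {s..t} - N" and "0 < e"
    have "((\<lambda>t. - x i t) has_real_derivative ?g i r) (at r within {s..t})"
      using st by (intro DERIV_minus x_deriv_subset[OF r _ _ i]) auto
    then obtain \<delta> where "\<delta> > 0" and \<delta>: "\<And>u v. s \<le> u \<Longrightarrow> u \<le> r \<Longrightarrow> r \<le> v \<Longrightarrow> v \<le> t \<Longrightarrow> v - u < \<delta> \<Longrightarrow>
       \<bar>- x i v - - x i u - ?g i r * (v - u)\<bar> \<le> e * (v - u)"
      by (rule has_real_derivative_straddle[where e = e]) (use r \<open>0 < e\<close> in auto)
    have "- x i v - - x i u \<le> (?g i r + e) * (v - u)"
      if "s \<le> u" "u \<le> r" "r \<le> v" "v \<le> t" "v - u < \<delta>" for u v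
      using \<delta>[OF that] unfolding distrib_right by linarith
    then show "\<exists>\<delta>>0. \<forall>u v. s \<le> u \<longrightarrow> u \<le> r \<longrightarrow> r \<le> v \<longrightarrow> v \<le> t \<longrightarrow> v - u < \<delta> \<longrightarrow>
        - x i v - - x i u \<le> (?g i r + e) * (v - u)"
      using \<open>\<delta> > 0\<close> by blast
  qed
  have "- (\<Sum>i<n. x i t) + (\<Sum>i<n. x i s) = (\<Sum>i<n. - x i t - - x i s)"
    by (simp add: sum_subtractf)
  also have "\<dots> \<le> (\<Sum>i<n. integral {s..t} (?g i))"
    using step by (intro sum_mono) auto
  also have "\<dots> = integral {s..t} (\<lambda>r. \<Sum>i<n. ?g i r)"
    using g_int by (intro integral_sum[symmetric]) auto
  also have "\<dots> \<le> integral {s..t} (\<lambda>r. \<beta> r * (\<Sum>i<n. x i r))"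
  proof (rule integral_le_negligible[OF _ _ N])
    show "(\<lambda>r. \<Sum>i<n. ?g i r) integrable_on {s..t}"
      by (rule integrable_sum) (use g_int in auto)
    show "(\<lambda>r. \<beta> r * (\<Sum>i<n. x i r)) integrable_on {s..t}"
      by (intro mult_integrable \<beta> V_cont st)
    fix r assume "r \<in> {s..t} - N"
    then have rb: "r \<in> {0..b} - N" using st by auto
    have "- (\<beta> r * (\<Sum>i<n. x i r)) = (\<Sum>j<n. - \<beta> r * x j r)"
      by (simp add: sum_distrib_left sum_negf)
    also have "\<dots> \<le> (\<Sum>j<n. (\<Sum>i<n. h i j r) * x j r)"
      using col[OF rb] x0 rb by (intro sum_mono mult_right_mono) auto
    also have "\<dots> = (\<Sum>i<n. \<Sum>j<n. h i j r * x j r)"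
      unfolding sum_distrib_right by (rule sum.swap)
    finally show "(\<Sum>i<n. ?g i r) \<le> \<beta> r * (\<Sum>i<n. x i r)"
      by (simp add: sum_negf)
  qed
  finally show "- integral {s..t} (\<lambda>r. \<beta> r * (\<Sum>i<n. x i r)) \<le> (\<Sum>i<n. x i t) - (\<Sum>i<n. x i s)"
    by simp
qed

end

subsection \<open>The matrix \<open>H\<close>\<close>

text \<open>Abel summation. With a row of the intensity matrix as \<open>c\<close> and tail sums as
  \<open>u\<close>, it turns the equation for state probabilities into one for tail sums, with
  differences of adjacent columns as coefficients.\<close>

lemma summation_by_parts:
  fixes c u :: "nat \<Rightarrow> real"
  shows "(\<Sum>j\<le>n. c j * (u j - u (Suc j))) =
    c 0 * u 0 - c n * u (Suc n) + (\<Sum>j<n. (c (Suc j) - c j) * u (Suc j))"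
  by (induction n) (simp_all add: algebra_simps)

text \<open>The diagonal entry is minus the total rate of leaving state \<open>j\<close>, so it
  balances the rates of arrival in the other states. Conservation of mass and the sign of
  \<open>H\<close> above the diagonal both rest on this.\<close>

lemma transposed_intensity_matrix_column_sum:
  assumes "j \<le> S"
  shows "(\<Sum>m\<le>S. transposed_intensity_matrix S q t $$ (m, j)) = 0"
proof -
  have "(\<Sum>m\<le>S. transposed_intensity_matrix S q t $$ (m, j))
      = transposed_intensity_matrix S q t $$ (j, j)
        + (\<Sum>m\<in>{..S} - {j}. transposed_intensity_matrix S q t $$ (m, j))"
    using assms by (intro sum.remove) auto
  also have "transposed_intensity_matrix S q t $$ (j, j) = - (\<Sum>m\<in>{..S} - {j}. q j m t)"
    using assms by (simp add: transposed_intensity_matrix_def atMost_atLeast0)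
  also have "(\<Sum>m\<in>{..S} - {j}. transposed_intensity_matrix S q t $$ (m, j)) = (\<Sum>m\<in>{..S} - {j}. q j m t)"
    using assms by (intro sum.cong) (auto simp: transposed_intensity_matrix_def)
  finally show ?thesis by simp
qed

lemma weight_matrix_index:
  "i < S \<Longrightarrow> j < S \<Longrightarrow> weight_matrix S d $$ (i, j) = (if i \<le> j then d (Suc i) else 0)"
  by (simp add: weight_matrix_def)

lemma weight_matrix_dim [simp]: "dim_row (weight_matrix S d) = S" "dim_col (weight_matrix S d) = S"
  by (simp_all add: weight_matrix_def)

lemma weight_matrix_mult_vec_index:
  assumes "i < S" "z \<in> carrier_vec S"
  shows "vec_index (weight_matrix S d *\<^sub>v z) i = d (Suc i) * (\<Sum>k=i..<S. vec_index z k)"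
proof -
  have "vec_index (weight_matrix S d *\<^sub>v z) i = (\<Sum>k=0..<S. (if i \<le> k then d (Suc i) else 0) * vec_index z k)"
    using assms
    by (simp add: scalar_prod_def weight_matrix_index)
  also have "\<dots> = (\<Sum>k=i..<S. d (Suc i) * vec_index z k)"
    using assms by (intro sum.mono_neutral_cong_right) auto
  finally show ?thesis by (simp add: sum_distrib_left)
qed

text \<open>The inverse of the weight matrix is never computed: \<open>G\<close> is the claimed
  matrix, \<open>G * ?D = ?D * ?B\<close> is checked by telescoping over adjacent columns, and
  \<open>?D\<close> is cancelled on the right with \<open>E\<close>. Differences of adjacent columns
  of the full matrix are also what summation by parts produces.\<close>

lemma H_matrix_index:
  fixes q :: "nat \<Rightarrow> nat \<Rightarrow> real \<Rightarrow> real" and t :: real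
  assumes d: "\<forall>k\<in>{1..S}. 0 < d k" and i: "i < S" and j: "j < S"
  defines "a \<equiv> \<lambda>m k. transposed_intensity_matrix S q t $$ (m, k)"
  shows "H_matrix S q d t $$ (i, j) = d (Suc i) / d (Suc j) * (\<Sum>k=i..<S. a (Suc k) (Suc j) - a (Suc k) j)"
proof -
  let ?D = "weight_matrix S d" and ?B = "reduced_matrix S (transposed_intensity_matrix S q t)"
  define G where "G = Matrix.mat S S
    (\<lambda>(i, j). d (Suc i) / d (Suc j) * (\<Sum>k=i..<S. a (Suc k) (Suc j) - a (Suc k) j))"
  obtain E where E: "mat_inverse ?D = Some E" "E \<in> carrier_mat S S" "?D * E = 1\<^sub>m S"
    using weight_matrix_inverse[OF d] by metis
  have carr: "G \<in> carrier_mat S S" "?D \<in> carrier_mat S S" "?B \<in> carrier_mat S S"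
    by (auto simp: G_def reduced_matrix_def weight_matrix_def)
  have "G * ?D = ?D * ?B"
  proof (rule eq_matI)
    fix i j assume "i < dim_row (?D * ?B)" "j < dim_col (?D * ?B)"
    then have ij: "i < S" "j < S" using carr by auto
    have "(G * ?D) $$ (i, j) = (\<Sum>k=0..<S. G $$ (i, k) * (if k \<le> j then d (Suc k) else 0))"
      using ij carr by (simp add: scalar_prod_def weight_matrix_index)
    also have "\<dots> = (\<Sum>k<Suc j. d (Suc i) * (\<Sum>l=i..<S. a (Suc l) (Suc k) - a (Suc l) k))"
    proof (rule sum.mono_neutral_cong_right)
      fix k assume k: "k \<in> {..<Suc j}"
      then have "d (Suc k) \<noteq> 0" using d[rule_format, of "Suc k"] ij by auto
      then show "G $$ (i, k) * (if k \<le> j then d (Suc k) else 0)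
          = d (Suc i) * (\<Sum>l=i..<S. a (Suc l) (Suc k) - a (Suc l) k)"
        using k ij by (simp add: G_def)
    qed (use ij in auto)
    also have "\<dots> = d (Suc i) * (\<Sum>l=i..<S. \<Sum>k<Suc j. a (Suc l) (Suc k) - a (Suc l) k)"
      unfolding sum_distrib_left[symmetric] by (subst sum.swap) (rule refl)
    \<comment> \<open>Column 0 of the full matrix, which \<open>reduced_matrix\<close> subtracts, is
      the lower end of the telescoping sum.\<close>
    also have "\<dots> = d (Suc i) * (\<Sum>l=i..<S. a (Suc l) (Suc j) - a (Suc l) 0)"
      by (simp only: sum_lessThan_telescope)
    also have "\<dots> = (\<Sum>l=i..<S. d (Suc i) * ?B $$ (l, j))"
      using ij by (simp add: sum_distrib_left reduced_matrix_def a_def)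
    also have "\<dots> = (\<Sum>l=0..<S. (if i \<le> l then d (Suc i) else 0) * ?B $$ (l, j))"
      using ij by (intro sum.mono_neutral_cong_left) auto
    also have "\<dots> = (?D * ?B) $$ (i, j)"
      using ij carr by (simp add: scalar_prod_def weight_matrix_index)
    finally show "(G * ?D) $$ (i, j) = (?D * ?B) $$ (i, j)" .
  qed (use carr in auto)
  then have "H_matrix S q d t = G * ?D * E"
    using E by (simp add: H_matrix_def)
  also have "\<dots> = G * (?D * E)"
    using carr E by (intro assoc_mult_mat)
  also have "\<dots> = G"
    using carr E by simp
  finally show ?thesis
    using i j by (simp add: G_def)
qed

text \<open>Below the diagonal each term of the tail sum is
  \<open>lam (k - j) t - lam (Suc (k - j)) t\<close>. Above it, the tail sum runs across the
  diagonal of the intensity matrix; as column sums are zero, it is replaced by minus the sum over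
  the rows up to \<open>i\<close>, whose terms are
  \<open>mu (j - m) t - mu (Suc (j - m)) t\<close>.\<close>

lemma H_matrix_nonneg:
  assumes d: "\<forall>k\<in>{1..S}. 0 < d k" and ij: "i < S" "j < S" "i \<noteq> j"
    and mono: "\<And>k. k \<in> {1..<S} \<Longrightarrow> lam (Suc k) t \<le> lam k t \<and> mu (Suc k) t \<le> mu k t"
  shows "0 \<le> H_matrix S (szk_intensity lam mu) d t $$ (i, j)"
proof -
  define a where "a m k = transposed_intensity_matrix S (szk_intensity lam mu) t $$ (m, k)" for m k
  have a_lower: "a m k = lam (m - k) t" if "k < m" "m \<le> S" for m k
    using that by (simp add: a_def transposed_intensity_matrix_def szk_intensity_def)
  have a_upper: "a m k = mu (k - m) t" if "m < k" "k \<le> S" for m k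
    using that by (simp add: a_def transposed_intensity_matrix_def szk_intensity_def)
  have "0 \<le> (\<Sum>k=i..<S. a (Suc k) (Suc j) - a (Suc k) j)"
  proof (cases "j < i")
    case True
    show ?thesis
    proof (rule sum_nonneg)
      fix k assume k: "k \<in> {i..<S}"
      then have "a (Suc k) (Suc j) = lam (k - j) t" "a (Suc k) j = lam (Suc (k - j)) t"
        using True ij by (simp_all add: a_lower Suc_diff_le)
      moreover have "k - j \<in> {1..<S}" using k True by auto
      ultimately show "0 \<le> a (Suc k) (Suc j) - a (Suc k) j"
        using mono[of "k - j"] by simp
    qed
  next
    case False
    with ij have "i < j" by simp
    let ?f = "\<lambda>m. a m (Suc j) - a m j"
    have "(\<Sum>m\<le>S. ?f m) = 0"
      using ij transposed_intensity_matrix_column_sum[of _ S "szk_intensity lam mu" t]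
      by (simp add: sum_subtractf a_def)
    moreover have "(\<Sum>m\<le>S. ?f m) = (\<Sum>m=0..<Suc i. ?f m) + (\<Sum>m=Suc i..<Suc S. ?f m)"
      using ij by (subst sum.atLeastLessThan_concat) (auto simp: atLeast0LessThan lessThan_Suc_atMost)
    moreover have "(\<Sum>m=Suc i..<Suc S. ?f m) = (\<Sum>k=i..<S. ?f (Suc k))"
      by (rule sum.shift_bounds_Suc_ivl)
    ultimately have "(\<Sum>k=i..<S. ?f (Suc k)) = (\<Sum>m=0..<Suc i. - ?f m)"
      unfolding sum_negf by linarith
    also have "0 \<le> \<dots>"
    proof (rule sum_nonneg)
      fix m assume m: "m \<in> {0..<Suc i}"
      then have "a m j = mu (j - m) t" "a m (Suc j) = mu (Suc (j - m)) t"
        using \<open>i < j\<close> ij by (simp_all add: a_upper Suc_diff_le)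
      moreover have "j - m \<in> {1..<S}" using m \<open>i < j\<close> ij by auto
      ultimately show "0 \<le> - ?f m"
        using mono[of "j - m"] by simp
    qed
    finally show ?thesis .
  qed
  moreover have "0 \<le> d (Suc i) / d (Suc j)"
    using d ij by (intro divide_nonneg_nonneg) (auto intro: less_imp_le)
  ultimately show ?thesis
    unfolding H_matrix_index[OF d ij(1,2)] a_def by (intro mult_nonneg_nonneg)
qed

lemma H_matrix_absolutely_integrable:
  assumes d: "\<forall>k\<in>{1..S}. 0 < d k" and ij: "i < S" "j < S"
    and int: "\<forall>k\<in>{1..S}. lam k absolutely_integrable_on I \<and> mu k absolutely_integrable_on I"
  shows "(\<lambda>t. H_matrix S (szk_intensity lam mu) d t $$ (i, j)) absolutely_integrable_on I"
proof -
  have q: "szk_intensity lam mu m k absolutely_integrable_on I" if "m \<le> S" "k \<le> S" for m k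
  proof -
    consider "m < k" | "k < m" | "m = k" by linarith
    then show ?thesis
    proof cases
      case 1
      then have "szk_intensity lam mu m k = lam (k - m)" by (auto simp: szk_intensity_def)
      moreover have "k - m \<in> {1..S}" using 1 that by auto
      ultimately show ?thesis using int by simp
    next
      case 2
      then have "szk_intensity lam mu m k = mu (m - k)" by (auto simp: szk_intensity_def)
      moreover have "m - k \<in> {1..S}" using 2 that by auto
      ultimately show ?thesis using int by simp
    next
      case 3
      then have "szk_intensity lam mu m k = (\<lambda>t. 0)" by (auto simp: szk_intensity_def)
      then show ?thesis by (simp add: set_integrable_def)
    qed
  qed
  have a: "(\<lambda>t. transposed_intensity_matrix S (szk_intensity lam mu) t $$ (m, k)) absolutely_integrable_on I"
    if "m \<le> S" "k \<le> S" for m k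
  proof (cases "m = k")
    case True
    have "(\<lambda>t. - 1 * (\<Sum>l\<in>{0..S} - {m}. szk_intensity lam mu m l t)) absolutely_integrable_on I"
      using that by (intro set_integrable_mult_right absolutely_integrable_sum q) auto
    then show ?thesis using that True by (simp add: transposed_intensity_matrix_def)
  next
    case False
    then show ?thesis
      using that q[of k m] by (simp add: transposed_intensity_matrix_def)
  qed
  show ?thesis
    unfolding H_matrix_index[OF d ij]
    by (intro set_integrable_mult_right absolutely_integrable_sum set_integral_diff(1) a) (use ij in auto)
qed

lemma alpha_Suc: "alpha S q d (Suc j) t = - (\<Sum>i<S. H_matrix S q d t $$ (i, j))"
  by (simp add: alpha_def sum.atLeast1_atMost_eq)

lemma beta_bounds:
  assumes "j < S"
  shows "(\<Sum>i<S. H_matrix S q d t $$ (i, j)) \<le> - beta_min S q d t"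
    and "- beta_max S q d t \<le> (\<Sum>i<S. H_matrix S q d t $$ (i, j))"
proof -
  have "beta_min S q d t \<le> alpha S q d (Suc j) t" "alpha S q d (Suc j) t \<le> beta_max S q d t"
    using assms unfolding beta_min_def beta_max_def by (intro Min_le Max_ge; force)+
  then show "(\<Sum>i<S. H_matrix S q d t $$ (i, j)) \<le> - beta_min S q d t"
    and "- beta_max S q d t \<le> (\<Sum>i<S. H_matrix S q d t $$ (i, j))"
    by (simp_all add: alpha_Suc)
qed

lemma beta_absolutely_integrable:
  assumes "S \<ge> 1" and d: "\<forall>k\<in>{1..S}. 0 < d k"
    and int: "\<forall>k\<in>{1..S}. lam k absolutely_integrable_on I \<and> mu k absolutely_integrable_on I"
  shows "beta_min S (szk_intensity lam mu) d absolutely_integrable_on I"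
    and "beta_max S (szk_intensity lam mu) d absolutely_integrable_on I"
proof -
  have alpha: "alpha S (szk_intensity lam mu) d k absolutely_integrable_on I" if k: "k \<in> {1..S}" for k
  proof -
    obtain j where j: "k = Suc j" "j < S" using k by (cases k) auto
    have "(\<lambda>t. - 1 * (\<Sum>i<S. H_matrix S (szk_intensity lam mu) d t $$ (i, j))) absolutely_integrable_on I"
      using j by (intro set_integrable_mult_right absolutely_integrable_sum
          H_matrix_absolutely_integrable[OF d _ _ int]) auto
    moreover have "alpha S (szk_intensity lam mu) d k
        = (\<lambda>t. - 1 * (\<Sum>i<S. H_matrix S (szk_intensity lam mu) d t $$ (i, j)))"
      using j by (simp add: alpha_Suc fun_eq_iff)
    ultimately show ?thesis by simp
  qed
  show "beta_min S (szk_intensity lam mu) d absolutely_integrable_on I"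
    unfolding beta_min_def[abs_def] using assms(1) alpha by (intro absolutely_integrable_Min) auto
  show "beta_max S (szk_intensity lam mu) d absolutely_integrable_on I"
    unfolding beta_max_def[abs_def] using assms(1) alpha by (intro absolutely_integrable_Max) auto
qed

subsection \<open>Differences of state probabilities\<close>

lemma forward_solution_difference:
  assumes p1: "forward_solution S q p1" and p2: "forward_solution S q p2"
  defines "w \<equiv> \<lambda>m t. vec_index (p1 t) m - vec_index (p2 t) m"
  obtains N where "negligible N"
    "\<And>t m. t \<in> {0..} - N \<Longrightarrow> m \<le> S \<Longrightarrow>
      (w m has_real_derivative (\<Sum>j\<le>S. transposed_intensity_matrix S q t $$ (m, j) * w j t))
        (at t within {0..})"
proof -
  have "\<exists>N. negligible N \<and> (\<forall>t\<in>{0..} - N. \<forall>i\<le>S.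
        ((\<lambda>s. vec_index (p s) i) has_real_derivative
           vec_index (transposed_intensity_matrix S q t *\<^sub>v p t) i) (at t within {0..}))"
    if "forward_solution S q p" for p
    using that unfolding forward_solution_def by (intro AE_lebesgue_on_negligible) auto
  then obtain N1 N2 where N: "negligible N1" "negligible N2"
    and N1: "\<And>t i. t \<in> {0..} - N1 \<Longrightarrow> i \<le> S \<Longrightarrow> ((\<lambda>s. vec_index (p1 s) i) has_real_derivative
           vec_index (transposed_intensity_matrix S q t *\<^sub>v p1 t) i) (at t within {0..})"
    and N2: "\<And>t i. t \<in> {0..} - N2 \<Longrightarrow> i \<le> S \<Longrightarrow> ((\<lambda>s. vec_index (p2 s) i) has_real_derivative
           vec_index (transposed_intensity_matrix S q t *\<^sub>v p2 t) i) (at t within {0..})"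
    using p1 p2 by meson
  have mult: "vec_index (transposed_intensity_matrix S q t *\<^sub>v p t) m
      = (\<Sum>j\<le>S. transposed_intensity_matrix S q t $$ (m, j) * vec_index (p t) j)"
    if "forward_solution S q p" "0 \<le> t" "m \<le> S" for p t m
  proof -
    have "p t \<in> carrier_vec (S + 1)"
      using that unfolding forward_solution_def by blast
    moreover have "{0..<Suc S} = {..S}" by auto
    ultimately show ?thesis
      using that(3) by (simp add: transposed_intensity_matrix_def scalar_prod_def)
  qed
  show ?thesis
  proof (rule that[of "N1 \<union> N2"])
    show "negligible (N1 \<union> N2)" using N by simp
    fix t m assume t: "t \<in> {0..} - (N1 \<union> N2)" and m: "m \<le> S"
    have "(w m has_real_derivative vec_index (transposed_intensity_matrix S q t *\<^sub>v p1 t) m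
        - vec_index (transposed_intensity_matrix S q t *\<^sub>v p2 t) m) (at t within {0..})"
      unfolding w_def using t m by (intro DERIV_diff N1 N2) auto
    then show "(w m has_real_derivative (\<Sum>j\<le>S. transposed_intensity_matrix S q t $$ (m, j) * w j t))
        (at t within {0..})"
      using t m mult[OF p1, of t m] mult[OF p2, of t m]
      by (simp add: w_def right_diff_distrib sum_subtractf)
  qed
qed

lemma ac_on_forward_solution_difference:
  assumes "forward_solution S q p1" "forward_solution S q p2" "0 \<le> T" "m \<le> S"
  shows "ac_on {0..T} (\<lambda>t. vec_index (p1 t) m - vec_index (p2 t) m)"
proof -
  have "ac_on {0..T} (\<lambda>t. vec_index (p t) m)" if "forward_solution S q p" for p
    using that assms(3,4) unfolding forward_solution_def by blast
  then have "ac_on {0..T} (\<lambda>t. vec_index (p1 t) m + - vec_index (p2 t) m)"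
    using assms(1,2) by (intro ac_on_add ac_on_minus)
  then show ?thesis by simp
qed

text \<open>Conservation of mass, as the one-dimensional cooperative system \<open>x' = 0\<close>.\<close>

lemma state_probabilities_difference_sum:
  assumes p1: "state_probabilities S q p1" and p2: "state_probabilities S q p2" and "0 \<le> T"
  shows "(\<Sum>m\<le>S. vec_index (p1 T) m - vec_index (p2 T) m) = 0"
proof -
  let ?w = "\<lambda>m t. vec_index (p1 t) m - vec_index (p2 t) m"
  let ?A = "\<lambda>t. transposed_intensity_matrix S q t"
  have f: "forward_solution S q p1" "forward_solution S q p2"
    using p1 p2 by (auto simp: state_probabilities_def)
  then obtain N where N: "negligible N" and deriv: "\<And>t m. t \<in> {0..} - N \<Longrightarrow> m \<le> S \<Longrightarrow>
      (?w m has_real_derivative (\<Sum>j\<le>S. ?A t $$ (m, j) * ?w j t)) (at t within {0..})"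
    using forward_solution_difference by blast
  interpret cooperative_system 1 "\<lambda>_ _ _. 0" "\<lambda>_ t. \<Sum>m\<le>S. ?w m t" N T
  proof
    show "ac_on {0..T} (\<lambda>t. \<Sum>m\<le>S. ?w m t)"
      using f \<open>0 \<le> T\<close> by (intro ac_on_sum ac_on_forward_solution_difference) auto
    fix t assume t: "t \<in> {0..T} - N"
    have "((\<lambda>t. \<Sum>m\<le>S. ?w m t) has_real_derivative (\<Sum>m\<le>S. \<Sum>j\<le>S. ?A t $$ (m, j) * ?w j t))
        (at t within {0..})"
      using t by (intro DERIV_sum deriv) auto
    also have "(\<Sum>m\<le>S. \<Sum>j\<le>S. ?A t $$ (m, j) * ?w j t) = (\<Sum>j\<le>S. (\<Sum>m\<le>S. ?A t $$ (m, j)) * ?w j t)"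
      unfolding sum_distrib_right by (rule sum.swap)
    also have "\<dots> = 0"
      by (intro sum.neutral) (simp add: transposed_intensity_matrix_column_sum)
    finally have "((\<lambda>t. \<Sum>m\<le>S. ?w m t) has_real_derivative 0) (at t within {0..T})"
      by (rule DERIV_subset) auto
    then show "((\<lambda>t. \<Sum>m\<le>S. ?w m t) has_real_derivative (\<Sum>j<1. 0 * (\<Sum>m\<le>S. ?w m t))) (at t within {0..T})"
      by simp
  qed (use N \<open>0 \<le> T\<close> in \<open>auto simp: set_integrable_def\<close>)
  \<comment> \<open>The system has zero coefficients, so the rate 0 is admissible, and the total
    difference is bounded by its initial absolute value, which is 0 because both initial vectors
    have mass 1.\<close>
  have "(\<Sum>i<1::nat. \<bar>\<Sum>m\<le>S. ?w m T\<bar>) \<le> exp (- integral {0..T} (\<lambda>_. 0)) * (\<Sum>i<1::nat. \<bar>\<Sum>m\<le>S. ?w m 0\<bar>)"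
    by (rule sum_abs_le) (auto simp: set_integrable_def)
  moreover have "(\<Sum>m\<le>S. vec_index (p 0) m) = 1" if "state_probabilities S q p" for p
    using that by (simp add: state_probabilities_def prob_vec_def lessThan_Suc_atMost)
  then have "(\<Sum>m\<le>S. ?w m 0) = 0"
    using p1 p2 by (simp add: sum_subtractf)
  ultimately show ?thesis by simp
qed

text \<open>The coordinates are those of the weight matrix applied to the difference of reduced
  vectors, written as weighted tail sums. Summation by parts in each row and summation over the rows
  from \<open>i + 1\<close> on give the entries of \<open>H\<close>, once the weight
  \<open>d (Suc j)\<close> is moved into the coordinate.\<close>

lemma difference_cooperative_system:
  fixes p1 p2 :: "real \<Rightarrow> real Matrix.vec"
  assumes d: "\<forall>k\<in>{1..S}. 0 < d k"
    and int: "\<forall>k\<in>{1..S}. lam k absolutely_integrable_on {0..T} \<and> mu k absolutely_integrable_on {0..T}"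
    and mono: "\<forall>k\<in>{1..<S}. AE t in lebesgue_on {0..}. lam (k + 1) t \<le> lam k t \<and> mu (k + 1) t \<le> mu k t"
    and p1: "state_probabilities S (szk_intensity lam mu) p1"
    and p2: "state_probabilities S (szk_intensity lam mu) p2"
    and T: "0 \<le> T"
  obtains N where "cooperative_system S (\<lambda>i j t. H_matrix S (szk_intensity lam mu) d t $$ (i, j))
    (\<lambda>i t. d (Suc i) * (\<Sum>m=Suc i..S. vec_index (p1 t) m - vec_index (p2 t) m)) N T"
proof -
  let ?w = "\<lambda>m t. vec_index (p1 t) m - vec_index (p2 t) m"
  let ?A = "\<lambda>t. transposed_intensity_matrix S (szk_intensity lam mu) t"
  let ?H = "\<lambda>t. H_matrix S (szk_intensity lam mu) d t"
  define u where "u j t = (\<Sum>m=j..S. ?w m t)" for j t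
  have f: "forward_solution S (szk_intensity lam mu) p1" "forward_solution S (szk_intensity lam mu) p2"
    using p1 p2 by (auto simp: state_probabilities_def)
  obtain N1 where N1: "negligible N1" and deriv: "\<And>t m. t \<in> {0..} - N1 \<Longrightarrow> m \<le> S \<Longrightarrow>
      (?w m has_real_derivative (\<Sum>j\<le>S. ?A t $$ (m, j) * ?w j t)) (at t within {0..})"
    using forward_solution_difference[OF f] by blast
  have "AE t in lebesgue_on {0..}. \<forall>k\<in>{1..<S}. lam (Suc k) t \<le> lam k t \<and> mu (Suc k) t \<le> mu k t"
    using mono by (intro AE_finite_allI) auto
  from AE_lebesgue_on_negligible[OF this] obtain N2 where N2: "negligible N2"
    and le: "\<And>t k. t \<in> {0..} - N2 \<Longrightarrow> k \<in> {1..<S} \<Longrightarrow> lam (Suc k) t \<le> lam k t \<and> mu (Suc k) t \<le> mu k t"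
    by auto
  have "cooperative_system S (\<lambda>i j t. ?H t $$ (i, j)) (\<lambda>i t. d (Suc i) * u (Suc i) t) (N1 \<union> N2) T"
  proof
    show "(\<lambda>t. ?H t $$ (i, j)) absolutely_integrable_on {0..T}" if "i < S" "j < S" for i j
      using H_matrix_absolutely_integrable[OF d that int] .
    show "ac_on {0..T} (\<lambda>t. d (Suc i) * u (Suc i) t)" if "i < S" for i
      unfolding u_def using f T
      by (intro ac_on_mult_left ac_on_sum ac_on_forward_solution_difference) auto
    show "0 \<le> ?H t $$ (i, j)" if "t \<in> {0..T} - (N1 \<union> N2)" "i < S" "j < S" "i \<noteq> j" for i j t
      using that by (intro H_matrix_nonneg[OF d]) (auto intro!: le)
    fix i t assume t: "t \<in> {0..T} - (N1 \<union> N2)" and i: "i < S"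
    \<comment> \<open>Both boundary terms of the summation by parts vanish: \<open>u 0\<close> is
      the total difference, zero by conservation of mass, and \<open>u (Suc S)\<close> is an empty
      sum. The first fact takes the place of eliminating the probability of state 0.\<close>
    have parts: "(\<Sum>j\<le>S. ?A t $$ (Suc k, j) * ?w j t)
        = (\<Sum>j<S. (?A t $$ (Suc k, Suc j) - ?A t $$ (Suc k, j)) * u (Suc j) t)" for k
    proof -
      have "u 0 t = 0"
        using state_probabilities_difference_sum[OF p1 p2, of t] t by (simp add: u_def atMost_atLeast0)
      moreover have "u (Suc S) t = 0" by (simp add: u_def)
      moreover have "?w j t = u j t - u (Suc j) t" if "j \<le> S" for j
        using that by (simp add: u_def sum.atLeast_Suc_atMost[of j S])
      then have "(\<Sum>j\<le>S. ?A t $$ (Suc k, j) * ?w j t) = (\<Sum>j\<le>S. ?A t $$ (Suc k, j) * (u j t - u (Suc j) t))"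
        by (intro sum.cong) auto
      ultimately show ?thesis
        using summation_by_parts[of "\<lambda>j. ?A t $$ (Suc k, j)" "\<lambda>j. u j t" S] by simp
    qed
    have "u (Suc i) = (\<lambda>t. \<Sum>k=i..<S. ?w (Suc k) t)"
      unfolding u_def atLeastLessThanSuc_atLeastAtMost[symmetric] by (simp only: sum.shift_bounds_Suc_ivl)
    moreover have "((\<lambda>t. d (Suc i) * (\<Sum>k=i..<S. ?w (Suc k) t)) has_real_derivative
        d (Suc i) * (\<Sum>k=i..<S. \<Sum>j\<le>S. ?A t $$ (Suc k, j) * ?w j t)) (at t within {0..})"
      using t by (intro DERIV_cmult DERIV_sum deriv) auto
    ultimately have "((\<lambda>t. d (Suc i) * u (Suc i) t) has_real_derivative
        d (Suc i) * (\<Sum>k=i..<S. \<Sum>j\<le>S. ?A t $$ (Suc k, j) * ?w j t)) (at t within {0..T})"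
      by (auto intro: DERIV_subset)
    also have "d (Suc i) * (\<Sum>k=i..<S. \<Sum>j\<le>S. ?A t $$ (Suc k, j) * ?w j t)
        = d (Suc i) * (\<Sum>j<S. (\<Sum>k=i..<S. ?A t $$ (Suc k, Suc j) - ?A t $$ (Suc k, j)) * u (Suc j) t)"
      unfolding parts sum_distrib_right by (subst sum.swap) (rule refl)
    also have "\<dots> = (\<Sum>j<S. ?H t $$ (i, j) * (d (Suc j) * u (Suc j) t))"
      unfolding sum_distrib_left
    proof (rule sum.cong)
      fix j assume "j \<in> {..<S}"
      then have "j < S" "d (Suc j) \<noteq> 0" using d[rule_format, of "Suc j"] by auto
      then show "d (Suc i) * ((\<Sum>k=i..<S. ?A t $$ (Suc k, Suc j) - ?A t $$ (Suc k, j)) * u (Suc j) t)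
          = ?H t $$ (i, j) * (d (Suc j) * u (Suc j) t)"
        using H_matrix_index[OF d i \<open>j < S\<close>] by simp
    qed simp
    finally show "((\<lambda>t. d (Suc i) * u (Suc i) t) has_real_derivative
        (\<Sum>j<S. ?H t $$ (i, j) * (d (Suc j) * u (Suc j) t))) (at t within {0..T})" .
  qed (use N1 N2 T in auto)
  then show ?thesis using that unfolding u_def by blast
qed

section \<open>The weighted norm and the tail sums of a difference\<close>

lemma weight_matrix_reduced_difference:
  assumes "i < S"
  shows "vec_index (weight_matrix S d *\<^sub>v (reduced_vec S x - reduced_vec S y)) i
    = d (Suc i) * (\<Sum>m=Suc i..S. vec_index x m - vec_index y m)"
proof -
  have "vec_index (weight_matrix S d *\<^sub>v (reduced_vec S x - reduced_vec S y)) i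
      = d (Suc i) * (\<Sum>k=i..<S. vec_index (reduced_vec S x - reduced_vec S y) k)"
    using assms by (intro weight_matrix_mult_vec_index) (auto simp: reduced_vec_def)
  also have "(\<Sum>k=i..<S. vec_index (reduced_vec S x - reduced_vec S y) k)
      = (\<Sum>k=i..<S. vec_index x (Suc k) - vec_index y (Suc k))"
    by (intro sum.cong) (auto simp: reduced_vec_def)
  also have "\<dots> = (\<Sum>m=Suc i..S. vec_index x m - vec_index y m)"
    unfolding atLeastLessThanSuc_atLeastAtMost[symmetric] by (simp only: sum.shift_bounds_Suc_ivl)
  finally show ?thesis .
qed

lemma norm_1D_reduced_difference:
  "norm_1D S d (reduced_vec S x - reduced_vec S y)
    = (\<Sum>i<S. \<bar>d (Suc i) * (\<Sum>m=Suc i..S. vec_index x m - vec_index y m)\<bar>)"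
  unfolding norm_1D_def l1_norm_def
  by (rule sum.cong) (simp_all only: weight_matrix_reduced_difference lessThan_iff dim_mult_mat_vec weight_matrix_dim)

text \<open>Each state probability is a difference of consecutive tail sums, and the tail sums are
  the coordinates of \<open>D z\<close> up to the weights.\<close>

lemma l1_norm_tendsto_0:
  fixes p1 p2 :: "real \<Rightarrow> real Matrix.vec"
  assumes d: "\<forall>k\<in>{1..S}. 0 < d k"
    and p1: "state_probabilities S q p1" and p2: "state_probabilities S q p2"
    and lim: "((\<lambda>t. norm_1D S d (reduced_vec S (p1 t) - reduced_vec S (p2 t))) \<longlongrightarrow> 0) at_top"
  shows "((\<lambda>t. l1_norm (p1 t - p2 t)) \<longlongrightarrow> 0) at_top"
proof -
  define u where "u j t = (\<Sum>m=j..S. vec_index (p1 t) m - vec_index (p2 t) m)" for j t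
  have u: "(u j \<longlongrightarrow> 0) at_top" for j
  proof -
    \<comment> \<open>The norm controls the tail sums from 1 to \<open>S\<close>. The full sum
      vanishes by conservation of mass, known for nonnegative times only, and beyond
      \<open>S\<close> the sum is empty.\<close>
    consider "j = 0" | "S < j" | i where "j = Suc i" "i < S"
      by (cases j; cases "S < j") auto
    then show ?thesis
    proof cases
      case 1
      have "eventually (\<lambda>t. u j t = 0) at_top"
        using eventually_ge_at_top[of 0]
        by eventually_elim (use 1 state_probabilities_difference_sum[OF p1 p2] in \<open>simp add: u_def atMost_atLeast0\<close>)
      then show ?thesis by (rule tendsto_eventually)
    next
      case 2
      then have "u j = (\<lambda>t. 0)" by (simp add: u_def fun_eq_iff)
      then show ?thesis by simp
    next
      case 3
      then have "d j > 0" using d by simp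
      have "norm (u j t) \<le> norm_1D S d (reduced_vec S (p1 t) - reduced_vec S (p2 t)) / d j" for t
      proof -
        have "\<bar>d (Suc i) * u (Suc i) t\<bar> \<le> (\<Sum>i<S. \<bar>d (Suc i) * u (Suc i) t\<bar>)"
          using 3 by (intro member_le_sum[where f = "\<lambda>i. \<bar>d (Suc i) * u (Suc i) t\<bar>"]) auto
        then show ?thesis
          using \<open>d j > 0\<close> 3 unfolding norm_1D_reduced_difference u_def[symmetric]
          by (simp add: abs_mult field_simps)
      qed
      then have "eventually (\<lambda>t. norm (u j t)
          \<le> norm_1D S d (reduced_vec S (p1 t) - reduced_vec S (p2 t)) / d j) at_top"
        by simp
      then show ?thesis
        by (rule Lim_null_comparison) (rule tendsto_divide_zero[OF lim])
    qed
  qed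
  have "((\<lambda>t. \<Sum>m\<le>S. \<bar>u m t - u (Suc m) t\<bar>) \<longlongrightarrow> (\<Sum>m\<le>S. \<bar>0 - 0\<bar>)) at_top"
    by (intro tendsto_intros u)
  moreover have "eventually (\<lambda>t. (\<Sum>m\<le>S. \<bar>u m t - u (Suc m) t\<bar>) = l1_norm (p1 t - p2 t)) at_top"
    using eventually_ge_at_top[of 0]
  proof eventually_elim
    case (elim t)
    then have c: "p1 t \<in> carrier_vec (S + 1)" "p2 t \<in> carrier_vec (S + 1)"
      using p1 p2 by (auto simp: state_probabilities_def forward_solution_def)
    have "(\<Sum>m\<le>S. \<bar>u m t - u (Suc m) t\<bar>) = (\<Sum>m\<le>S. \<bar>vec_index (p1 t) m - vec_index (p2 t) m\<bar>)"
      by (intro sum.cong) (auto simp: u_def sum.atLeast_Suc_atMost)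
    also have "\<dots> = l1_norm (p1 t - p2 t)"
      unfolding l1_norm_def using c by (intro sum.cong) auto
    finally show ?case .
  qed
  ultimately show ?thesis by (simp add: tendsto_cong)
qed

section \<open>Exponential bounds and weak ergodicity of the chain\<close>

theorem theorem3:
  fixes S :: nat and lam mu :: "nat \<Rightarrow> real \<Rightarrow> real" and d :: "nat \<Rightarrow> real"
    and q :: "nat \<Rightarrow> nat \<Rightarrow> real \<Rightarrow> real"
  assumes "S \<ge> 1"
    and "\<forall>k\<in>{1..S}. \<forall>t\<ge>0. 0 \<le> lam k t \<and> 0 \<le> mu k t"
    and "\<forall>k\<in>{1..S}. \<forall>T\<ge>0. lam k absolutely_integrable_on {0..T} \<and> mu k absolutely_integrable_on {0..T}"
    and "\<forall>k\<in>{1..<S}. AE t in lebesgue_on {0..}. lam (k + 1) t \<le> lam k t \<and> mu (k + 1) t \<le> mu k t"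
    and "q = szk_intensity lam mu"
    and "\<forall>k\<in>{1..S}. 0 < d k"
    and "filterlim (\<lambda>T. integral {0..T} (beta_min S q d)) at_top at_top"
  shows "weakly_ergodic S q \<and>
    (\<forall>p1 p2. state_probabilities S q p1 \<longrightarrow> state_probabilities S q p2 \<longrightarrow>
       (\<forall>t\<ge>0. norm_1D S d (reduced_vec S (p1 t) - reduced_vec S (p2 t))
          \<le> exp (- integral {0..t} (beta_min S q d))
             * norm_1D S d (reduced_vec S (p1 0) - reduced_vec S (p2 0))) \<and>
       (0\<^sub>v S \<le> weight_matrix S d *\<^sub>v (reduced_vec S (p1 0) - reduced_vec S (p2 0)) \<longrightarrow>
         (\<forall>t\<ge>0. norm_1D S d (reduced_vec S (p1 t) - reduced_vec S (p2 t))
            \<ge> exp (- integral {0..t} (beta_max S q d))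
               * norm_1D S d (reduced_vec S (p1 0) - reduced_vec S (p2 0)))))"
proof -
  note d = assms(6)
  have int: "\<forall>k\<in>{1..S}. lam k absolutely_integrable_on {0..T} \<and> mu k absolutely_integrable_on {0..T}"
    if "0 \<le> T" for T
    using assms(3) that by blast
  \<comment> \<open>The exceptional set may depend on the horizon \<open>T\<close>, as the bounds
    are proved for each \<open>T\<close> separately.\<close>
  have system: "\<exists>N. cooperative_system S (\<lambda>i j t. H_matrix S q d t $$ (i, j))
      (\<lambda>i t. d (Suc i) * (\<Sum>m=Suc i..S. vec_index (p1 t) m - vec_index (p2 t) m)) N T"
    if "state_probabilities S q p1" "state_probabilities S q p2" "0 \<le> T" for p1 p2 T
    using difference_cooperative_system[OF d int[OF that(3)] assms(4) that(1,2)[unfolded assms(5)] that(3)]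
    unfolding assms(5) by blast
  have upper: "norm_1D S d (reduced_vec S (p1 T) - reduced_vec S (p2 T))
      \<le> exp (- integral {0..T} (beta_min S q d)) * norm_1D S d (reduced_vec S (p1 0) - reduced_vec S (p2 0))"
    if "state_probabilities S q p1" "state_probabilities S q p2" "0 \<le> T" for p1 p2 T
  proof -
    obtain N where "cooperative_system S (\<lambda>i j t. H_matrix S q d t $$ (i, j))
      (\<lambda>i t. d (Suc i) * (\<Sum>m=Suc i..S. vec_index (p1 t) m - vec_index (p2 t) m)) N T"
      using system[OF \<open>state_probabilities S q p1\<close> \<open>state_probabilities S q p2\<close> \<open>0 \<le> T\<close>] by blast
    then interpret cooperative_system S "\<lambda>i j t. H_matrix S q d t $$ (i, j)"
      "\<lambda>i t. d (Suc i) * (\<Sum>m=Suc i..S. vec_index (p1 t) m - vec_index (p2 t) m)" N T .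
    show ?thesis
      unfolding norm_1D_reduced_difference
      using beta_absolutely_integrable(1)[OF assms(1) d int[OF \<open>0 \<le> T\<close>]] beta_bounds(1)
      unfolding assms(5) [symmetric] by (rule sum_abs_le)
  qed
  have lower: "exp (- integral {0..T} (beta_max S q d)) * norm_1D S d (reduced_vec S (p1 0) - reduced_vec S (p2 0))
      \<le> norm_1D S d (reduced_vec S (p1 T) - reduced_vec S (p2 T))"
    if "state_probabilities S q p1" "state_probabilities S q p2" "0 \<le> T"
      "0\<^sub>v S \<le> weight_matrix S d *\<^sub>v (reduced_vec S (p1 0) - reduced_vec S (p2 0))" for p1 p2 T
  proof -
    let ?x = "\<lambda>i t. d (Suc i) * (\<Sum>m=Suc i..S. vec_index (p1 t) m - vec_index (p2 t) m)"
    obtain N where "cooperative_system S (\<lambda>i j t. H_matrix S q d t $$ (i, j)) ?x N T"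
      using system[OF \<open>state_probabilities S q p1\<close> \<open>state_probabilities S q p2\<close> \<open>0 \<le> T\<close>] by blast
    then interpret cooperative_system S "\<lambda>i j t. H_matrix S q d t $$ (i, j)" ?x N T .
    have init: "0 \<le> ?x i 0" if "i < S" for i
      using \<open>0\<^sub>v S \<le> _\<close> that weight_matrix_reduced_difference[OF that, of d "p1 0" "p2 0"]
      by (auto simp: less_eq_vec_def)
    have le: "exp (- integral {0..T} (beta_max S q d)) * (\<Sum>i<S. ?x i 0) \<le> (\<Sum>i<S. ?x i T)"
    proof (rule sum_ge)
      show "beta_max S q d absolutely_integrable_on {0..T}"
        unfolding assms(5) by (rule beta_absolutely_integrable(2)[OF assms(1) d int[OF \<open>0 \<le> T\<close>]])
    qed (use init beta_bounds(2) in auto)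
    \<comment> \<open>The norm equals the plain sum at time 0 by the sign of the initial difference;
      at time \<open>T\<close> it is enough that the norm is at least the sum.\<close>
    have "(\<Sum>i<S. \<bar>?x i 0\<bar>) = (\<Sum>i<S. ?x i 0)"
      using init by (intro sum.cong) auto
    moreover have "(\<Sum>i<S. ?x i T) \<le> (\<Sum>i<S. \<bar>?x i T\<bar>)"
      by (intro sum_mono abs_ge_self)
    with le have "exp (- integral {0..T} (beta_max S q d)) * (\<Sum>i<S. ?x i 0) \<le> (\<Sum>i<S. \<bar>?x i T\<bar>)"
      by (rule order_trans)
    ultimately show ?thesis
      by (simp only: norm_1D_reduced_difference)
  qed
  have "weakly_ergodic S q"
    unfolding weakly_ergodic_def
  proof (intro allI impI)
    fix p1 p2 assume p: "state_probabilities S q p1" "state_probabilities S q p2"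
    have "((\<lambda>T. exp (- integral {0..T} (beta_min S q d))) \<longlongrightarrow> 0) at_top"
      using assms(7) by (intro filterlim_compose[OF exp_at_bot]) (simp add: filterlim_uminus_at_bot)
    then have bound: "((\<lambda>T. exp (- integral {0..T} (beta_min S q d))
        * norm_1D S d (reduced_vec S (p1 0) - reduced_vec S (p2 0))) \<longlongrightarrow> 0) at_top"
      by (rule tendsto_mult_left_zero)
    have "((\<lambda>T. norm_1D S d (reduced_vec S (p1 T) - reduced_vec S (p2 T))) \<longlongrightarrow> 0) at_top"
    proof (rule tendsto_sandwich[OF _ _ tendsto_const bound])
      show "eventually (\<lambda>T. 0 \<le> norm_1D S d (reduced_vec S (p1 T) - reduced_vec S (p2 T))) at_top"
        by (simp add: norm_1D_def l1_norm_def sum_nonneg)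
      show "eventually (\<lambda>T. norm_1D S d (reduced_vec S (p1 T) - reduced_vec S (p2 T))
          \<le> exp (- integral {0..T} (beta_min S q d))
            * norm_1D S d (reduced_vec S (p1 0) - reduced_vec S (p2 0))) at_top"
        using eventually_ge_at_top[of 0] by eventually_elim (rule upper[OF p])
    qed
    then show "((\<lambda>t. l1_norm (p1 t - p2 t)) \<longlongrightarrow> 0) at_top"
      using d p by (intro l1_norm_tendsto_0)
  qed
  then show ?thesis using upper lower by blast
qed

end
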